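(* Let $\mathscr{H}_S$ be a complex Hilbert space of finite dimension $d_S$, $\mathscr{H}_E$ a complex Hilbert space, $(U_t)_{t\ge 0}$ a family of unitary operators on $\mathscr{H}_S\otimes\mathscr{H}_E$, $\rho_E$ a density operator on $\mathscr{H}_E$, and $\chi$ a Hermitian trace-class operator on $\mathscr{H}_S\otimes\mathscr{H}_E$ with $\mathrm{Tr}_E\{\chi\}=0$ and $\mathrm{Tr}_S\{\chi\}=0$. For $X\in\mathcal{B}(\mathscr{H}_S)$ put $$\Phi_t[X]=\mathrm{Tr}_E\{U_t(X\otimes\rho_E)U_t^\dagger\},\quad I_t^\chi=\mathrm{Tr}_E\{U_t\chi U_t^\dagger\},\quad \Psi_t^\chi[X]=\Phi_t[X]+I_t^\chi\,\mathrm{Tr}\{X\}.$$ Assume that $t\mapsto\Phi_t$ and $t\mapsto I_t^\chi$ are differentiable and let $t$ be such that $\Phi_t$ is invertible. Set $\mathcal{L}_t=\dot\Phi_t\circ\Phi_t^{-1}$, $\mathcal{L}_t^\chi=\dot\Psi_t^\chi\circ(\Psi_t^\chi)^{-1}$ and $\mathcal{J}_t^\chi=\dot I_t^\chi-\mathcal{L}_t[I_t^\chi]$. Let $(|\eta_j\rangle)_{j=1}^{d_S}$ be an orthonormal basis of eigenvectors of the Hermitian operator $\mathcal{J}_t^\chi$ with eigenvalues $b_j\in\mathbb{R}$, and for each double index $i=(j,j')$ put $$G_i=|\eta_j\rangle\langle\eta_{j'}|,\qquad g_i=b_j,\qquad J_i=G_i-\frac{\mathrm{Tr}\{G_i\}}{d_S}\,\mathbb{I}.$$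 Then the superoperator $X\mapsto\mathcal{J}_t^\chi\,\mathrm{Tr}\{X\}$ is a pure dissipator with traceless Lindblad operators and vanishing Hamiltonian part: for all $X\in\mathcal{B}(\mathscr{H}_S)$, $$\mathcal{J}_t^\chi\,\mathrm{Tr}\{X\}=d_t^\chi[X]:=\sum_i g_i\Big[J_iXJ_i^\dagger-\tfrac12\{J_i^\dagger J_i,X\}\Big],$$ and $$k_S^\chi:=\frac{1}{2\mathrm{i}\,d_S}\sum_i g_i\big[\mathrm{Tr}\{G_i\}G_i^\dagger-\mathrm{Tr}\{G_i^\dagger\}G_i\big]=0 .$$ Consequently, if the uncorrelated generator is written as $$\mathcal{L}_t[X]=-\mathrm{i}[K_S,X]+\sum_k\lambda_k\Big[L_kXL_k^\dagger-\tfrac12\{L_k^\dagger L_k,X\}\Big]$$ with $K_S$ Hermitian, $\lambda_k\in\mathbb{R}$ and traceless operators $L_k$, then $$\mathcal{L}_t^\chi[X]=-\mathrm{i}[K_S,X]+\sum_k\lambda_k\Big[L_kXL_k^\dagger-\tfrac12\{L_k^\dagger L_k,X\}\Big]+\sum_i g_i\Big[J_iXJ_i^\dagger-\tfrac12\{J_i^\dagger J_i,X\}\Big]$$ for all $X\in\mathcal{B}(\mathscr{H}_S)$; in particular the Hamiltonian $K_S$ is left unaltered by the initial correlations $\chi$.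
   Context: $\mathcal{B}(\mathscr{H}_S)$ is the space of linear operators on $\mathscr{H}_S$. $\mathrm{Tr}_E$ and $\mathrm{Tr}_S$ are the partial traces over $\mathscr{H}_E$ and $\mathscr{H}_S$. A dot denotes the derivative with respect to $t$; $[A,B]=AB-BA$ and $\{A,B\}=AB+BA$, while $\mathrm{Tr}\{A\}$ denotes the trace of $A$. When $\Phi_t$ is invertible, $\Psi_t^\chi$ is invertible as well, with inverse $X\mapsto\Phi_t^{-1}[X]-\Phi_t^{-1}[I_t^\chi]\,\mathrm{Tr}\{X\}$. All of $K_S,\lambda_k,L_k,g_i,G_i,J_i,b_j,|\eta_j\rangle$ may depend on $t$. *)

theory Defs
  imports "HOL-Analysis.Analysis" "HOL-Library.Nonpos_Ints"
begin

section \<open>Complex Hilbert spaces\<close>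

class scaleC =
  fixes scaleC :: "complex \<Rightarrow> 'a \<Rightarrow> 'a" (infixr "*\<^sub>C" 75)

text \<open>Inner products are linear in the second argument. The norm and the topology are
  those of the underlying real inner product space, whose inner product is the real part
  of the complex one.\<close>

class complex_inner = real_inner + scaleC +
  fixes cinner :: "'a \<Rightarrow> 'a \<Rightarrow> complex"
  assumes scaleC_add_right: "a *\<^sub>C (x + y) = a *\<^sub>C x + a *\<^sub>C y"
    and scaleC_add_left: "(a + b) *\<^sub>C x = a *\<^sub>C x + b *\<^sub>C x"
    and scaleC_scaleC: "a *\<^sub>C b *\<^sub>C x = (a * b) *\<^sub>C x"
    and scaleR_scaleC: "r *\<^sub>R x = complex_of_real r *\<^sub>C x"
    and cinner_commute: "cinner x y = cnj (cinner y x)"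
    and cinner_add_right: "cinner x (y + z) = cinner x y + cinner x z"
    and cinner_scaleC_right: "cinner x (a *\<^sub>C y) = a * cinner x y"
    and Re_cinner: "Re (cinner x y) = inner x y"

class chilbert_space = complex_inner + banach

instantiation complex :: complex_inner
begin
definition scaleC_complex :: "complex \<Rightarrow> complex \<Rightarrow> complex"
  where "scaleC_complex a x = a * x"
definition cinner_complex :: "complex \<Rightarrow> complex \<Rightarrow> complex"
  where "cinner_complex x y = cnj x * y"
instance
  by standard
    (auto simp: scaleC_complex_def cinner_complex_def algebra_simps inner_complex_def
      scaleR_conv_of_real)
end

instance complex :: chilbert_space ..

text \<open>The direct sum of copies of a Hilbert space indexed by a finite type. In particular
  \<open>complex^'n\<close> is the Hilbert space of dimension \<open>CARD('n)\<close>.\<close>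

instantiation vec :: (complex_inner, finite) complex_inner
begin
definition scaleC_vec :: "complex \<Rightarrow> 'a^'b \<Rightarrow> 'a^'b"
  where "scaleC_vec a x = (\<chi> i. a *\<^sub>C x $ i)"
definition cinner_vec :: "'a^'b \<Rightarrow> 'a^'b \<Rightarrow> complex"
  where "cinner_vec x y = (\<Sum>i\<in>UNIV. cinner (x $ i) (y $ i))"
instance
proof
  fix a b :: complex and r :: real and x y z :: "'a^'b"
  show "a *\<^sub>C (x + y) = a *\<^sub>C x + a *\<^sub>C y" "(a + b) *\<^sub>C x = a *\<^sub>C x + b *\<^sub>C x"
    "a *\<^sub>C b *\<^sub>C x = (a * b) *\<^sub>C x" "r *\<^sub>R x = complex_of_real r *\<^sub>C x"
    by (simp_all add: scaleC_vec_def vec_eq_iff scaleC_add_right scaleC_add_left scaleC_scaleC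
        scaleR_scaleC)
  show "cinner x y = cnj (cinner y x)"
    unfolding cinner_vec_def cnj_sum by (intro sum.cong refl cinner_commute)
  show "cinner x (y + z) = cinner x y + cinner x z"
    by (simp add: cinner_vec_def cinner_add_right sum.distrib)
  show "cinner x (a *\<^sub>C y) = a * cinner x y"
    by (simp add: cinner_vec_def scaleC_vec_def cinner_scaleC_right sum_distrib_left)
  show "Re (cinner x y) = inner x y"
    by (simp add: cinner_vec_def inner_vec_def Re_cinner)
qed
end

instance vec :: (chilbert_space, finite) chilbert_space ..


section \<open>Operators, trace class, trace\<close>

definition bounded_clinear :: "('a::complex_inner \<Rightarrow> 'b::complex_inner) \<Rightarrow> bool" where
  "bounded_clinear A \<longleftrightarrow> bounded_linear A \<and> (\<forall>a x. A (a *\<^sub>C x) = a *\<^sub>C A x)"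

definition cadjoint :: "('a::complex_inner \<Rightarrow> 'b::complex_inner) \<Rightarrow> 'b \<Rightarrow> 'a" where
  "cadjoint A = (SOME B. \<forall>x y. cinner (B y) x = cinner y (A x))"

definition unitary_op :: "('a::complex_inner \<Rightarrow> 'a) \<Rightarrow> bool" where
  "unitary_op U \<longleftrightarrow> bounded_clinear U \<and> cadjoint U \<circ> U = id \<and> U \<circ> cadjoint U = id"

definition hermitian_op :: "('a::complex_inner \<Rightarrow> 'a) \<Rightarrow> bool" where
  "hermitian_op A \<longleftrightarrow> bounded_clinear A \<and> (\<forall>x y. cinner (A x) y = cinner x (A y))"

definition positive_op :: "('a::complex_inner \<Rightarrow> 'a) \<Rightarrow> bool" where
  "positive_op A \<longleftrightarrow> bounded_clinear A \<and> (\<forall>x. cinner x (A x) \<in> \<real>\<^sub>\<ge>\<^sub>0)"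

definition is_onb :: "'a::complex_inner set \<Rightarrow> bool" where
  "is_onb B \<longleftrightarrow> (\<forall>e\<in>B. \<forall>f\<in>B. cinner e f = (if e = f then 1 else 0)) \<and>
    (\<forall>x. (\<forall>e\<in>B. cinner e x = 0) \<longrightarrow> x = 0)"

definition some_onb :: "'a::chilbert_space set" where
  "some_onb = (SOME B. is_onb B)"

text \<open>\<open>T\<close> is trace class if \<open>|T|\<close>, the positive square root of \<open>T\<^sup>\<dagger>T\<close>, has finite trace. The
  operator \<open>P\<close> below is \<open>|T|\<close>; it is unique, and whether its trace is finite does not depend
  on the orthonormal basis.\<close>

definition trace_class :: "('a::chilbert_space \<Rightarrow> 'a) \<Rightarrow> bool" where
  "trace_class T \<longleftrightarrow> bounded_clinear T \<and>
    (\<exists>P B. positive_op P \<and> P \<circ> P = cadjoint T \<circ> T \<and>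
       is_onb B \<and> (\<lambda>e. cinner e (P e)) summable_on B)"

definition op_trace :: "('a::chilbert_space \<Rightarrow> 'a) \<Rightarrow> complex" where
  "op_trace T = (\<Sum>\<^sub>\<infinity>e\<in>some_onb. cinner e (T e))"

definition density_op :: "('a::chilbert_space \<Rightarrow> 'a) \<Rightarrow> bool" where
  "density_op T \<longleftrightarrow> positive_op T \<and> trace_class T \<and> op_trace T = 1"


section \<open>Matrices\<close>

text \<open>The system space is \<open>complex^'n\<close>, and its operators are the matrices \<open>complex^'n^'n\<close>.\<close>

definition mdagger :: "complex^'n^'n \<Rightarrow> complex^'n^'n" where
  "mdagger A = (\<chi> i j. cnj (A $ j $ i))"

definition hermitian_mat :: "complex^'n^'n \<Rightarrow> bool" where
  "hermitian_mat A \<longleftrightarrow> mdagger A = A"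

definition ketbra :: "complex^'n \<Rightarrow> complex^'n \<Rightarrow> complex^'n^'n" where
  "ketbra x y = (\<chi> i j. x $ i * cnj (y $ j))"

definition commutator :: "complex^'n^'n \<Rightarrow> complex^'n^'n \<Rightarrow> complex^'n^'n" where
  "commutator A B = A ** B - B ** A"

definition anticommutator :: "complex^'n^'n \<Rightarrow> complex^'n^'n \<Rightarrow> complex^'n^'n" where
  "anticommutator A B = A ** B + B ** A"

lemma cinner_mdagger: "cinner (mdagger A *v x) y = cinner x (A *v y)"
  for A :: "complex^'n::finite^'n"
proof -
  have "cinner (mdagger A *v x) y = (\<Sum>i\<in>UNIV. \<Sum>j\<in>UNIV. A $ j $ i * cnj (x $ j) * y $ i)"
    by (simp add: cinner_vec_def cinner_complex_def mdagger_def matrix_vector_mult_def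
        sum_distrib_right)
  also have "\<dots> = (\<Sum>j\<in>UNIV. \<Sum>i\<in>UNIV. A $ j $ i * cnj (x $ j) * y $ i)"
    by (rule sum.swap)
  also have "\<dots> = cinner x (A *v y)"
    by (simp add: cinner_vec_def cinner_complex_def matrix_vector_mult_def
        sum_distrib_left mult_ac)
  finally show ?thesis .
qed

lemma ketbra_apply: "ketbra x y *v z = cinner y z *\<^sub>C x"
  for x :: "complex^'n::finite"
  by (simp add: ketbra_def matrix_vector_mult_def vec_eq_iff scaleC_vec_def scaleC_complex_def
      cinner_vec_def cinner_complex_def sum_distrib_left sum_distrib_right mult_ac)


section \<open>Tensor product and partial traces\<close>

text \<open>The Hilbert space tensor product of \<open>complex^'n\<close> and \<open>'e\<close> is realised as the direct sum
  \<open>'e^'n\<close>: the component \<open>v $ i\<close> of \<open>v\<close> is its \<open>'e\<close>-part along the \<open>i\<close>-th standard basis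
  vector of \<open>complex^'n\<close>.\<close>

definition tensor_vec :: "complex^'n \<Rightarrow> 'e::complex_inner \<Rightarrow> 'e^'n" where
  "tensor_vec x y = (\<chi> i. x $ i *\<^sub>C y)"

definition tensor_op ::
  "complex^'n^'n \<Rightarrow> ('e::complex_inner \<Rightarrow> 'e) \<Rightarrow> 'e^'n \<Rightarrow> 'e^'n" where
  "tensor_op X R v = (\<chi> i. \<Sum>j\<in>UNIV. X $ i $ j *\<^sub>C R (v $ j))"

lemma cinner_scaleC_left: "cinner (a *\<^sub>C x) y = cnj a * cinner x y"
  by (metis cinner_commute cinner_scaleC_right complex_cnj_mult)

lemma cinner_tensor_vec:
  "cinner (tensor_vec x y) (tensor_vec x' y') = cinner x x' * cinner y y'"
  by (simp add: tensor_vec_def cinner_vec_def cinner_complex_def cinner_scaleC_left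
      cinner_scaleC_right sum_distrib_right sum_distrib_left mult_ac)

lemma sum_scaleC: "finite A \<Longrightarrow> A \<noteq> {} \<Longrightarrow> (\<Sum>j\<in>A. f j *\<^sub>C y) = (\<Sum>j\<in>A. f j) *\<^sub>C y"
  for y :: "'a::complex_inner"
  by (induction A rule: finite_ne_induct) (simp_all add: scaleC_add_left)

lemma tensor_op_tensor_vec:
  assumes "bounded_clinear R"
  shows "tensor_op X R (tensor_vec x y) = tensor_vec (X *v x) (R y)"
  using assms
  by (simp add: tensor_vec_def tensor_op_def vec_eq_iff bounded_clinear_def scaleC_scaleC
      matrix_vector_mult_def sum_scaleC)

definition ptrace_E :: "('e::chilbert_space^'n \<Rightarrow> 'e^'n) \<Rightarrow> complex^'n^'n" where
  "ptrace_E T = (\<chi> i j. \<Sum>\<^sub>\<infinity>e\<in>some_onb.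
     cinner (tensor_vec (axis i 1) e) (T (tensor_vec (axis j 1) e)))"

definition ptrace_S :: "('e::chilbert_space^'n \<Rightarrow> 'e^'n) \<Rightarrow> 'e \<Rightarrow> 'e" where
  "ptrace_S T y = (\<Sum>i\<in>UNIV. T (tensor_vec (axis i 1) y) $ i)"


section \<open>Reduced dynamics\<close>

definition Phi ::
  "(real \<Rightarrow> 'e::chilbert_space^'n \<Rightarrow> 'e^'n) \<Rightarrow> ('e \<Rightarrow> 'e) \<Rightarrow> real \<Rightarrow> complex^'n^'n \<Rightarrow> complex^'n^'n"
  where "Phi U \<rho> t X = ptrace_E (U t \<circ> tensor_op X \<rho> \<circ> cadjoint (U t))"

definition Icorr ::
  "(real \<Rightarrow> 'e::chilbert_space^'n \<Rightarrow> 'e^'n) \<Rightarrow> ('e^'n \<Rightarrow> 'e^'n) \<Rightarrow> real \<Rightarrow> complex^'n^'n"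
  where "Icorr U chi t = ptrace_E (U t \<circ> chi \<circ> cadjoint (U t))"

definition Psi ::
  "(real \<Rightarrow> 'e::chilbert_space^'n \<Rightarrow> 'e^'n) \<Rightarrow> ('e \<Rightarrow> 'e) \<Rightarrow> ('e^'n \<Rightarrow> 'e^'n) \<Rightarrow>
    real \<Rightarrow> complex^'n^'n \<Rightarrow> complex^'n^'n"
  where "Psi U \<rho> chi t X = Phi U \<rho> t X + trace X *\<^sub>C Icorr U chi t"

text \<open>Time runs over \<open>{0..}\<close>, so derivatives are one-sided at \<open>0\<close>. As \<open>B(H\<^sub>S)\<close> is
  finite-dimensional, families of superoperators are differentiated pointwise.\<close>

definition tdifferentiable :: "(real \<Rightarrow> 'a::real_normed_vector) \<Rightarrow> bool" where
  "tdifferentiable f \<longleftrightarrow> (\<forall>t\<ge>0. f differentiable (at t within {0..}))"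

definition tderiv :: "(real \<Rightarrow> 'a::real_normed_vector) \<Rightarrow> real \<Rightarrow> 'a" where
  "tderiv f t = vector_derivative f (at t within {0..})"

definition generator ::
  "(real \<Rightarrow> complex^'n^'n \<Rightarrow> complex^'n^'n) \<Rightarrow> real \<Rightarrow> complex^'n^'n \<Rightarrow> complex^'n^'n" where
  "generator F t = (\<lambda>Y. tderiv (\<lambda>s. F s Y) t) \<circ> inv (F t)"

definition Jcorr ::
  "(real \<Rightarrow> 'e::chilbert_space^'n \<Rightarrow> 'e^'n) \<Rightarrow> ('e \<Rightarrow> 'e) \<Rightarrow> ('e^'n \<Rightarrow> 'e^'n) \<Rightarrow>
    real \<Rightarrow> complex^'n^'n"
  where "Jcorr U \<rho> chi t =
    tderiv (Icorr U chi) t - generator (Phi U \<rho>) t (Icorr U chi t)"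

definition dissipator ::
  "'k set \<Rightarrow> ('k \<Rightarrow> real) \<Rightarrow> ('k \<Rightarrow> complex^'n^'n) \<Rightarrow> complex^'n^'n \<Rightarrow> complex^'n^'n" where
  "dissipator A lam L X = (\<Sum>k\<in>A. lam k *\<^sub>R
     (L k ** X ** mdagger (L k) - (1/2) *\<^sub>R anticommutator (mdagger (L k) ** L k) X))"

definition traceless_part :: "complex^'n^'n \<Rightarrow> complex^'n^'n" where
  "traceless_part G = G - (trace G / of_nat CARD('n)) *\<^sub>C mat 1"

definition corr_hamiltonian ::
  "'k set \<Rightarrow> ('k \<Rightarrow> real) \<Rightarrow> ('k \<Rightarrow> complex^'n^'n) \<Rightarrow> complex^'n^'n" where
  "corr_hamiltonian A g G = (1 / (2 * \<i> * of_nat CARD('n))) *\<^sub>C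
     (\<Sum>i\<in>A. g i *\<^sub>R (trace (G i) *\<^sub>C mdagger (G i) - trace (mdagger (G i)) *\<^sub>C G i))"

end

theory Submission
  imports Defs
begin

text \<open>The trace of a trace class operator does not depend on the orthonormal basis, so \<open>\<Phi>\<^sub>t\<close>
  preserves the trace and \<open>I\<^sub>t\<close> is traceless. Hence \<open>J\<^sub>t\<close> is Hermitian and traceless, and
  \<open>\<L>\<^sub>t\<^sup>\<chi>[X] = \<L>\<^sub>t[X] + Tr X \<cdot> J\<^sub>t\<close>. For an eigenbasis of \<open>J\<^sub>t\<close>,
  \<open>\<Sum>\<^sub>j\<^sub>k b\<^sub>j (|j\<rangle>\<langle>k| X |k\<rangle>\<langle>j| - {|k\<rangle>\<langle>k|, X} / 2) = Tr X \<cdot> J\<^sub>t - Tr J\<^sub>t \<cdot> X = Tr X \<cdot> J\<^sub>t\<close>. Passing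
  to the traceless parts changes nothing: it affects only the \<open>|j\<rangle>\<langle>j|\<close>, which are Hermitian with
  real trace, so the Hamiltonian correction vanishes.

  Basis independence for a positive operator reduces to a finite inequality, proved by Cholesky
  elimination. A Hermitian trace class \<open>T\<close> is a difference of two positive operators of
  finite trace because \<open>-|T| \<le> T \<le> |T|\<close>.\<close>

section \<open>Complex inner product spaces\<close>

text \<open>The partial trace is an infinite sum along the one basis \<open>some_onb\<close>, and a
  divergent \<open>infsum\<close> has the value 0. Additivity of \<open>ptrace_E\<close> and
  invariance of its trace under unitary conjugation can therefore fail for arbitrary bounded
  operators, while \<open>trace_class\<close> supplies convergence only for the absolute value and
  in an unspecified basis. The linear span of the positive operators of finite trace closes this
  gap: for positive operators convergence does not depend on the basis, conjugation by
  \<open>U\<close> is a change of basis, and linearity does the rest. No spectral theorem for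
  operators on \<open>'e\<close> enters. What remains is finite-dimensional algebra. Since
  \<open>Phi\<close> keeps the trace and \<open>Icorr\<close> is traceless, \<open>Psi\<close> keeps
  the trace too; so the multiple of \<open>Icorr\<close> contained in an output of
  \<open>Psi\<close> can be read off that output and subtracted before \<open>Phi\<close> is
  inverted.\<close>

lemma cinner_add_left: "cinner (x + y) z = cinner x z + cinner y z"
  by (metis cinner_commute cinner_add_right complex_cnj_add)

lemma cinner_scaleR_right: "cinner x (r *\<^sub>R y) = r *\<^sub>R cinner x y"
  by (metis scaleR_scaleC cinner_scaleC_right scaleR_conv_of_real)

lemma cinner_scaleR_left: "cinner (r *\<^sub>R x) y = r *\<^sub>R cinner x y"
  by (metis scaleR_scaleC cinner_scaleC_left scaleR_conv_of_real complex_cnj_complex_of_real)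

lemma cinner_self: "cinner x x = complex_of_real ((norm x)\<^sup>2)"
proof (rule complex_eqI)
  have "Im (cinner x x) = - Im (cinner x x)"
    by (metis cinner_commute cnj.sel(2))
  then show "Im (cinner x x) = Im (complex_of_real ((norm x)\<^sup>2))"
    by simp
qed (simp add: Re_cinner power2_norm_eq_inner)

lemma cnj_mult_self: "cnj z * z = complex_of_real ((cmod z)\<^sup>2)"
  by (metis complex_norm_square mult.commute)

lemma norm_scaleC: "norm (a *\<^sub>C x) = cmod a * norm x" for x :: "'a::complex_inner"
proof -
  have "cinner (a *\<^sub>C x) (a *\<^sub>C x) = (a * cnj a) * cinner x x"
    by (simp add: cinner_scaleC_left cinner_scaleC_right mult_ac)
  then have "complex_of_real ((norm (a *\<^sub>C x))\<^sup>2) = complex_of_real ((cmod a * norm x)\<^sup>2)"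
    unfolding cinner_self complex_norm_square[symmetric] of_real_mult[symmetric]
      power_mult_distrib .
  then show ?thesis
    by (simp only: of_real_eq_iff power2_eq_iff_nonneg norm_ge_zero mult_nonneg_nonneg)
qed

text \<open>A phase \<open>a\<close> makes the inner product real and positive, which reduces the
  claim to Cauchy-Schwarz for the underlying real inner product.\<close>

lemma norm_cinner_le: "cmod (cinner x y) \<le> norm x * norm y"
proof (cases "cinner x y = 0")
  case False
  define a where "a = cnj (cinner x y) / cmod (cinner x y)"
  have a: "cmod a = 1"
    using False by (simp add: a_def norm_divide)
  have "a * cinner x y = complex_of_real (cmod (cinner x y))"
    using False complex_norm_square[of "cinner x y"]
    by (simp add: a_def power2_eq_square mult.commute field_simps)
  then have "cmod (cinner x y) = inner x (a *\<^sub>C y)"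
    by (simp add: Re_cinner[symmetric] cinner_scaleC_right)
  also have "\<dots> \<le> norm x * norm (a *\<^sub>C y)"
    by (rule norm_cauchy_schwarz)
  finally show ?thesis
    by (simp add: norm_scaleC a)
qed simp

lemma bounded_linear_cinner_right: "bounded_linear (cinner x)"
  by (rule bounded_linear_intro[where K = "norm x"])
    (simp_all add: cinner_add_right cinner_scaleR_right,
      metis norm_cinner_le mult.commute)

lemma bounded_linear_cinner_left: "bounded_linear (\<lambda>x. cinner x y)"
  by (rule bounded_linear_intro[where K = "norm y"])
    (simp_all add: cinner_add_left cinner_scaleR_left norm_cinner_le)

lemma bounded_linear_scaleC_right: "bounded_linear (\<lambda>x :: 'a::complex_inner. a *\<^sub>C x)"
  by (rule bounded_linear_intro[where K = "cmod a"])
    (simp_all add: scaleC_add_right norm_scaleC scaleR_scaleC scaleC_scaleC mult.commute)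

lemma bounded_linear_scaleC_left: "bounded_linear (\<lambda>a. a *\<^sub>C (x :: 'a::complex_inner))"
  by (rule bounded_linear_intro[where K = "norm x"])
    (simp_all add: scaleC_add_left norm_scaleC scaleR_scaleC[where 'a = 'a] scaleC_scaleC
      scaleR_conv_of_real)

lemmas cinner_zero_right [simp] = linear_0[OF bounded_linear.linear[OF bounded_linear_cinner_right]]
  and cinner_zero_left [simp] = linear_0[OF bounded_linear.linear[OF bounded_linear_cinner_left]]
  and cinner_minus_right = linear_neg[OF bounded_linear.linear[OF bounded_linear_cinner_right]]
  and cinner_minus_left = linear_neg[OF bounded_linear.linear[OF bounded_linear_cinner_left]]
  and cinner_diff_right = linear_diff[OF bounded_linear.linear[OF bounded_linear_cinner_right]]
  and cinner_sum_right = linear_sum[OF bounded_linear.linear[OF bounded_linear_cinner_right]]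
  and cinner_sum_left = linear_sum[OF bounded_linear.linear[OF bounded_linear_cinner_left]]
  and scaleC_zero_right [simp] = linear_0[OF bounded_linear.linear[OF bounded_linear_scaleC_right]]
  and scaleC_zero_left [simp] = linear_0[OF bounded_linear.linear[OF bounded_linear_scaleC_left]]
  and scaleC_minus_left = linear_neg[OF bounded_linear.linear[OF bounded_linear_scaleC_left]]
  and scaleC_diff_right = linear_diff[OF bounded_linear.linear[OF bounded_linear_scaleC_right]]
  and scaleC_sum_right = linear_sum[OF bounded_linear.linear[OF bounded_linear_scaleC_right]]

lemma scaleC_one [simp]: "1 *\<^sub>C x = x" for x :: "'a::complex_inner"
  using scaleR_scaleC[of 1 x] by simp

lemma cinner_ext: "(\<And>z. cinner z x = cinner z y) \<Longrightarrow> x = y"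
  by (metis Re_cinner inner_commute vector_eq_ldot)

lemma norm_eq_of_cinner: "cinner x x = cinner y y \<Longrightarrow> norm x = norm y"
  by (simp add: cinner_self del: of_real_power)


section \<open>Orthonormal bases\<close>

text \<open>\<open>is_onb\<close> without its completeness clause; this weaker property passes to
  subsets, in particular to the finite ones on which norms are computed.\<close>

definition orthonormal :: "'a::complex_inner set \<Rightarrow> bool" where
  "orthonormal B \<longleftrightarrow> (\<forall>e\<in>B. \<forall>f\<in>B. cinner e f = (if e = f then 1 else 0))"

lemma orthonormalD:
  "orthonormal B \<Longrightarrow> e \<in> B \<Longrightarrow> f \<in> B \<Longrightarrow> cinner e f = (if e = f then 1 else 0)"
  unfolding orthonormal_def by blast

lemma orthonormal_subset: "orthonormal B \<Longrightarrow> A \<subseteq> B \<Longrightarrow> orthonormal A"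
  unfolding orthonormal_def by blast

lemma is_onb_orthonormal: "is_onb B \<Longrightarrow> orthonormal B"
  by (simp add: is_onb_def orthonormal_def)

lemma is_onb_eq_zero: "is_onb B \<Longrightarrow> (\<And>e. e \<in> B \<Longrightarrow> cinner e x = 0) \<Longrightarrow> x = 0"
  by (simp add: is_onb_def)

text \<open>Zorn: a maximal orthonormal set is a basis, since a nonzero vector orthogonal to all of
  it could be normalised and added.\<close>

lemma is_onb_exists: "\<exists>B :: 'a::complex_inner set. is_onb B"
proof -
  have "\<exists>M\<in>Collect orthonormal. \<forall>X\<in>Collect orthonormal. M \<subseteq> X \<longrightarrow> X = (M :: 'a set)"
  proof (rule subset_Zorn')
    fix C :: "'a set set"
    assume C: "subset.chain (Collect orthonormal) C"
    have "cinner e f = (if e = f then 1 else 0)" if ef: "e \<in> \<Union>C" "f \<in> \<Union>C" for e f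
    proof -
      obtain X where "X \<in> C" "e \<in> X" "f \<in> X"
        using ef C unfolding subset_chain_def by blast
      then show ?thesis
        using C unfolding subset_chain_def orthonormal_def by blast
    qed
    then show "\<Union>C \<in> Collect orthonormal"
      by (simp add: orthonormal_def)
  qed
  then obtain M :: "'a set" where M: "orthonormal M"
    and max: "\<And>X. orthonormal X \<Longrightarrow> M \<subseteq> X \<Longrightarrow> X = M"
    by auto
  have "x = 0" if x: "\<forall>e\<in>M. cinner e x = 0" for x
  proof (rule ccontr)
    assume "x \<noteq> 0"
    define y where "y = (1 / norm x) *\<^sub>R x"
    have y: "cinner y y = 1"
      using \<open>x \<noteq> 0\<close> by (simp add: y_def cinner_self)
    have ey: "cinner e y = 0" "cinner y e = 0" if "e \<in> M" for e
      using x that cinner_commute[of y e] by (simp_all add: y_def cinner_scaleR_right)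
    have "y \<notin> M"
      using ey(1)[of y] y by auto
    then have "orthonormal (insert y M)"
      using y ey unfolding orthonormal_def by (auto dest: orthonormalD[OF M])
    then have "insert y M = M"
      using max[of "insert y M"] by blast
    then show False
      using \<open>y \<notin> M\<close> by blast
  qed
  then have "is_onb M"
    using M unfolding is_onb_def orthonormal_def by blast
  then show ?thesis
    by blast
qed

lemma some_onb: "is_onb some_onb"
  unfolding some_onb_def by (rule someI_ex[OF is_onb_exists])

lemma norm_sum_orthonormal:
  assumes "orthonormal B" "finite F" "F \<subseteq> B"
  shows "(norm (\<Sum>e\<in>F. c e *\<^sub>C e))\<^sup>2 = (\<Sum>e\<in>F. (cmod (c e))\<^sup>2)"
proof -
  have "cinner (\<Sum>e\<in>F. c e *\<^sub>C e) (\<Sum>e\<in>F. c e *\<^sub>C e)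
      = (\<Sum>e\<in>F. \<Sum>f\<in>F. cnj (c e) * c f * cinner e f)"
    by (simp add: cinner_sum_left cinner_sum_right cinner_scaleC_left cinner_scaleC_right
        sum_distrib_left mult_ac) (rule sum.swap)
  also have "\<dots> = (\<Sum>e\<in>F. \<Sum>f\<in>F. if e = f then cnj (c e) * c f else 0)"
    using assms(3) by (intro sum.cong refl) (auto simp: orthonormalD[OF assms(1)] subset_iff)
  also have "\<dots> = (\<Sum>e\<in>F. cnj (c e) * c e)"
    using assms(2) by simp
  finally show ?thesis
    unfolding cinner_self cnj_mult_self of_real_sum[symmetric] of_real_eq_iff .
qed

text \<open>The projection \<open>s\<close> of \<open>x\<close> onto the span of \<open>F\<close>
  satisfies \<open>Re (cinner s x) = (norm s)\<^sup>2\<close>, so Cauchy-Schwarz bounds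
  \<open>norm s\<close> by \<open>norm x\<close>.\<close>

lemma Bessel:
  assumes "orthonormal F" "finite F"
  shows "(\<Sum>f\<in>F. (cmod (cinner f x))\<^sup>2) \<le> (norm x)\<^sup>2"
proof -
  define s where "s = (\<Sum>f\<in>F. cinner f x *\<^sub>C f)"
  have ns: "(norm s)\<^sup>2 = (\<Sum>f\<in>F. (cmod (cinner f x))\<^sup>2)"
    unfolding s_def using assms by (intro norm_sum_orthonormal) auto
  have "cinner s x = (\<Sum>f\<in>F. complex_of_real ((cmod (cinner f x))\<^sup>2))"
    unfolding s_def cinner_sum_left cinner_scaleC_left cnj_mult_self ..
  then have "Re (cinner s x) = (norm s)\<^sup>2"
    by (simp only: of_real_sum[symmetric] Re_complex_of_real ns)
  then have "(norm s)\<^sup>2 \<le> norm s * norm x"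
    by (metis Re_cinner norm_cauchy_schwarz)
  then have "norm s \<le> norm x"
    by (metis linorder_not_le mult_le_cancel_left_pos norm_ge_zero order.strict_trans1 power2_eq_square)
  then show ?thesis
    using ns by (metis norm_ge_zero power_mono)
qed

text \<open>The squared distance of two nested partial sums is the sum of the squared coefficients
  over the difference, so the partial sums form a Cauchy net. This is where completeness of the
  space enters.\<close>

lemma Riesz_Fischer:
  fixes B :: "'a::chilbert_space set"
  assumes B: "orthonormal B"
    and bdd: "\<And>F. finite F \<Longrightarrow> F \<subseteq> B \<Longrightarrow> (\<Sum>e\<in>F. (cmod (c e))\<^sup>2) \<le> K"
  obtains y where "((\<lambda>e. c e *\<^sub>C e) has_sum y) B" "\<And>e. e \<in> B \<Longrightarrow> cinner e y = c e"
proof -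
  let ?a = "\<lambda>e. (cmod (c e))\<^sup>2" and ?s = "sum (\<lambda>e. c e *\<^sub>C e)"
  have summ: "?a summable_on B"
    by (rule nonneg_bdd_above_summable_on) (auto simp: bdd_above_def intro!: exI[of _ K] bdd)
  let ?S = "infsum ?a B"
  have "cauchy_filter (filtermap ?s (finite_subsets_at_top B))"
    unfolding cauchy_filter_metric_filtermap
  proof (intro allI impI)
    fix \<epsilon> :: real
    assume \<epsilon>: "\<epsilon> > 0"
    have lim: "(sum ?a \<longlongrightarrow> ?S) (finite_subsets_at_top B)"
      using has_sum_infsum[OF summ] unfolding has_sum_def .
    \<comment> \<open>The tolerance is squared because \<open>?a\<close> sums to squared norms. Two
      arbitrary large sets are compared through the fixed \<open>F0\<close>, hence the half.\<close>
    have "(\<epsilon> / 2)\<^sup>2 > 0"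
      using \<epsilon> by simp
    from tendstoD[OF lim this] obtain F0 where F0: "finite F0" "F0 \<subseteq> B"
      and lt: "\<forall>F. finite F \<and> F0 \<subseteq> F \<and> F \<subseteq> B \<longrightarrow> dist (sum ?a F) ?S < (\<epsilon> / 2)\<^sup>2"
      unfolding eventually_finite_subsets_at_top by (elim exE conjE)
    have close: "dist (?s F) (?s F0) < \<epsilon> / 2" if F: "finite F" "F0 \<subseteq> F" "F \<subseteq> B" for F
    proof -
      have "?s F - ?s F0 = ?s (F - F0)" "sum ?a F - sum ?a F0 = sum ?a (F - F0)"
        using F by (simp_all add: sum_diff)
      moreover have "(norm (?s (F - F0)))\<^sup>2 = sum ?a (F - F0)"
        using F by (intro norm_sum_orthonormal[OF B]) auto
      moreover have "sum ?a F \<le> ?S"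
        using F by (intro finite_sum_le_infsum summ) auto
      moreover have "?S - sum ?a F0 < (\<epsilon> / 2)\<^sup>2"
        using lt[rule_format, of F0] F0 by (simp add: dist_real_def)
      ultimately have "(dist (?s F) (?s F0))\<^sup>2 < (\<epsilon> / 2)\<^sup>2"
        by (simp add: dist_norm)
      then show ?thesis
        using \<epsilon> by (rule_tac power_less_imp_less_base[of _ 2]) auto
    qed
    show "\<exists>P. eventually P (finite_subsets_at_top B) \<and>
        (\<forall>F G. P F \<and> P G \<longrightarrow> dist (?s F) (?s G) < \<epsilon>)"
    proof (intro exI conjI allI impI)
      show "\<forall>\<^sub>F F in finite_subsets_at_top B. finite F \<and> F0 \<subseteq> F \<and> F \<subseteq> B"
        using F0 unfolding eventually_finite_subsets_at_top by blast
      fix F G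
      assume "(finite F \<and> F0 \<subseteq> F \<and> F \<subseteq> B) \<and> (finite G \<and> F0 \<subseteq> G \<and> G \<subseteq> B)"
      then show "dist (?s F) (?s G) < \<epsilon>"
        using close[of F] close[of G] dist_triangle_half_l by blast
    qed
  qed
  then have "convergent_filter (filtermap ?s (finite_subsets_at_top B))"
    by (simp add: cauchy_filter_convergent)
  then obtain y where y: "((\<lambda>e. c e *\<^sub>C e) has_sum y) B"
    unfolding convergent_filter_iff has_sum_def filterlim_def by blast
  show thesis
  proof (rule that[OF y])
    fix e
    assume e: "e \<in> B"
    have "((\<lambda>f. cinner e (c f *\<^sub>C f)) has_sum cinner e y) B"
      using has_sum_bounded_linear[OF bounded_linear_cinner_right y] by (simp add: o_def)
    moreover have "((\<lambda>f. cinner e (c f *\<^sub>C f)) has_sum c e) B"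
    proof -
      have "((\<lambda>f. cinner e (c f *\<^sub>C f)) has_sum (\<Sum>f\<in>{e}. cinner e (c f *\<^sub>C f))) {e}"
        by (rule has_sum_finite) simp
      moreover have "(\<Sum>f\<in>{e}. cinner e (c f *\<^sub>C f)) = c e"
        using e by (simp add: cinner_scaleC_right orthonormalD[OF B])
      ultimately have "((\<lambda>f. cinner e (c f *\<^sub>C f)) has_sum c e) {e}"
        by simp
      then show ?thesis
        by (subst has_sum_cong_neutral[of "{e}" B])
          (use e in \<open>auto simp: cinner_scaleC_right orthonormalD[OF B]\<close>)
    qed
    ultimately show "cinner e y = c e"
      by (rule has_sum_unique)
  qed
qed

text \<open>By Bessel the series has some sum \<open>y\<close>; then \<open>y - x\<close> is
  orthogonal to the whole basis and thus zero.\<close>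

lemma onb_expansion:
  fixes x :: "'a::chilbert_space"
  assumes "is_onb B"
  shows "((\<lambda>e. cinner e x *\<^sub>C e) has_sum x) B"
proof -
  note B = is_onb_orthonormal[OF assms]
  obtain y where y: "((\<lambda>e. cinner e x *\<^sub>C e) has_sum y) B"
    and ey: "\<And>e. e \<in> B \<Longrightarrow> cinner e y = cinner e x"
    by (rule Riesz_Fischer[OF B, where c = "\<lambda>e. cinner e x" and K = "(norm x)\<^sup>2"])
      (auto intro!: Bessel orthonormal_subset[OF B])
  have "y - x = 0"
    by (rule is_onb_eq_zero[OF assms]) (simp add: cinner_diff_right ey)
  then show ?thesis
    using y by simp
qed

text \<open>The representing vector has the coefficients \<open>cnj (\<phi> e)\<close>. They are
  square summable: a partial sum \<open>z\<close> satisfies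
  \<open>\<phi> z = (norm z)\<^sup>2\<close>, so the bound \<open>K\<close> of \<open>\<phi>\<close>
  forces \<open>norm z \<le> K\<close>.\<close>

lemma Riesz_representation:
  fixes \<phi> :: "'a::chilbert_space \<Rightarrow> complex"
  assumes "bounded_linear \<phi>" and scaleC: "\<And>a x. \<phi> (a *\<^sub>C x) = a * \<phi> x"
  obtains y where "\<And>x. cinner y x = \<phi> x"
proof -
  obtain B :: "'a set" where onb: "is_onb B"
    using is_onb_exists by blast
  note B = is_onb_orthonormal[OF onb]
  interpret bounded_linear \<phi> by fact
  obtain K where K: "K \<ge> 0" "\<And>x. norm (\<phi> x) \<le> norm x * K"
    using nonneg_bounded by blast
  obtain y where y: "\<And>e. e \<in> B \<Longrightarrow> cinner e y = cnj (\<phi> e)"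
  proof (rule Riesz_Fischer[OF B, where c = "\<lambda>e. cnj (\<phi> e)" and K = "K\<^sup>2"])
    fix F
    assume F: "finite F" "F \<subseteq> B"
    define z where "z = (\<Sum>e\<in>F. cnj (\<phi> e) *\<^sub>C e)"
    have nz: "(norm z)\<^sup>2 = (\<Sum>e\<in>F. (cmod (cnj (\<phi> e)))\<^sup>2)"
      unfolding z_def by (rule norm_sum_orthonormal[OF B F])
    have "\<phi> z = (\<Sum>e\<in>F. complex_of_real ((cmod (cnj (\<phi> e)))\<^sup>2))"
      unfolding z_def sum scaleC cnj_mult_self complex_mod_cnj ..
    then have "\<phi> z = complex_of_real ((norm z)\<^sup>2)"
      by (simp only: nz of_real_sum)
    then have "(norm z)\<^sup>2 \<le> norm z * K"
      using K(2)[of z] by (simp add: norm_power)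
    then have "norm z \<le> K"
      using K(1)
      by (metis linorder_not_le mult_le_cancel_left_pos norm_ge_zero order.strict_trans1 power2_eq_square)
    then show "(\<Sum>e\<in>F. (cmod (cnj (\<phi> e)))\<^sup>2) \<le> K\<^sup>2"
      unfolding nz[symmetric] by (simp add: power_mono)
  qed blast
  have "cinner y x = \<phi> x" for x
  proof -
    have "\<phi> (cinner e x *\<^sub>C e) = cinner y (cinner e x *\<^sub>C e)" if "e \<in> B" for e
      using y[OF that] cinner_commute[of y e] by (simp add: scaleC cinner_scaleC_right)
    then have "((\<lambda>e. cinner y (cinner e x *\<^sub>C e)) has_sum t) B
        \<longleftrightarrow> ((\<lambda>e. \<phi> (cinner e x *\<^sub>C e)) has_sum t) B" for t
      by (intro has_sum_cong) simp
    moreover have "((\<lambda>e. \<phi> (cinner e x *\<^sub>C e)) has_sum \<phi> x) B"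
      using has_sum_bounded_linear[OF \<open>bounded_linear \<phi>\<close> onb_expansion[OF onb, of x]]
      by (simp add: o_def)
    moreover have "((\<lambda>e. cinner y (cinner e x *\<^sub>C e)) has_sum cinner y x) B"
      using has_sum_bounded_linear[OF bounded_linear_cinner_right onb_expansion[OF onb, of x]]
      by (simp add: o_def)
    ultimately show ?thesis
      using has_sum_unique by blast
  qed
  then show thesis
    by (rule that)
qed

section \<open>Bounded operators and adjoints\<close>

lemma bounded_clinearD:
  assumes "bounded_clinear A"
  shows "bounded_linear A" "A (x + y) = A x + A y" "A (x - y) = A x - A y" "A (- x) = - A x"
    "A 0 = 0" "A (a *\<^sub>C x) = a *\<^sub>C A x" "A (r *\<^sub>R x) = r *\<^sub>R A x" "A (sum f F) = (\<Sum>i\<in>F. A (f i))"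
  using assms
  by (auto simp: bounded_clinear_def bounded_linear.linear linear_add linear_diff linear_neg
      linear_0 linear_scale linear_sum)

lemma bounded_clinear_add:
  "bounded_clinear A \<Longrightarrow> bounded_clinear B \<Longrightarrow> bounded_clinear (\<lambda>x. A x + B x)"
  by (simp add: bounded_clinear_def bounded_linear_add scaleC_add_right)

lemma bounded_clinear_diff:
  "bounded_clinear A \<Longrightarrow> bounded_clinear B \<Longrightarrow> bounded_clinear (\<lambda>x. A x - B x)"
  by (simp add: bounded_clinear_def bounded_linear_sub scaleC_diff_right)

lemma bounded_clinear_comp:
  "bounded_clinear A \<Longrightarrow> bounded_clinear B \<Longrightarrow> bounded_clinear (A \<circ> B)"
  by (auto simp: bounded_clinear_def o_def intro: bounded_linear_compose)

lemma bounded_clinear_scaleC: "bounded_clinear A \<Longrightarrow> bounded_clinear (\<lambda>x. c *\<^sub>C A x)"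
  unfolding bounded_clinear_def
  by (auto simp: scaleC_scaleC mult.commute intro: bounded_linear_compose[OF bounded_linear_scaleC_right])

lemma bounded_clinear_rank_one: "bounded_clinear (\<lambda>x. cinner w x *\<^sub>C z)"
  unfolding bounded_clinear_def
  by (auto simp: scaleC_scaleC cinner_scaleC_right
      intro: bounded_linear_compose[OF bounded_linear_scaleC_left bounded_linear_cinner_right])

text \<open>\<open>cadjoint\<close> is a \<open>SOME\<close> choice, so its defining equation needs
  a witness, which Riesz representation provides.\<close>

lemma cadjoint_cinner:
  fixes A :: "'a::chilbert_space \<Rightarrow> 'b::complex_inner"
  assumes "bounded_clinear A"
  shows "cinner (cadjoint A y) x = cinner y (A x)"
proof -
  have "\<exists>z. \<forall>x. cinner z x = cinner y (A x)" for y
  proof (rule Riesz_representation[of "\<lambda>x. cinner y (A x)"])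
    show "bounded_linear (\<lambda>x. cinner y (A x))"
      using bounded_linear_compose[OF bounded_linear_cinner_right bounded_clinearD(1)[OF assms]] .
  qed (auto simp: bounded_clinearD[OF assms] cinner_scaleC_right)
  then have "\<exists>B. \<forall>x y. cinner (B y) x = cinner y (A x)"
    by metis
  from someI_ex[OF this] show ?thesis
    unfolding cadjoint_def by blast
qed

lemma cadjoint_eqI:
  fixes A :: "'a::complex_inner \<Rightarrow> 'b::complex_inner"
  assumes "\<And>x y. cinner (B y) x = cinner y (A x)"
  shows "cadjoint A = B"
proof
  fix y
  have "\<forall>x y. cinner (cadjoint A y) x = cinner y (A x)"
    unfolding cadjoint_def by (rule someI[of _ B]) (simp add: assms)
  then have "cinner z (cadjoint A y) = cinner z (B y)" for z
    using assms cinner_commute by metis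
  then show "cadjoint A y = B y"
    by (rule cinner_ext)
qed

context
  fixes U :: "'a::chilbert_space \<Rightarrow> 'a"
  assumes U: "unitary_op U"
begin

lemma unitary_cadjoint_cancel: "cadjoint U (U x) = x" "U (cadjoint U x) = x"
  using U by (auto simp: unitary_op_def fun_eq_iff)

lemma unitary_cadjoint_cinner: "cinner (cadjoint U x) y = cinner x (U y)"
  using U cadjoint_cinner by (auto simp: unitary_op_def)

lemma unitary_cadjoint_cinner_right: "cinner x (cadjoint U y) = cinner (U x) y"
  by (metis unitary_cadjoint_cinner cinner_commute)

lemma cinner_cadjoint_unitary: "cinner (cadjoint U x) (cadjoint U y) = cinner x y"
  by (simp add: unitary_cadjoint_cinner unitary_cadjoint_cancel)

lemma bounded_clinear_unitary: "bounded_clinear U"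
  using U by (simp add: unitary_op_def)

lemma bounded_clinear_cadjoint_unitary: "bounded_clinear (cadjoint U)"
proof -
  have add: "cadjoint U (x + y) = cadjoint U x + cadjoint U y" for x y
    by (rule cinner_ext) (simp add: unitary_cadjoint_cinner_right cinner_add_right)
  have scale: "cadjoint U (a *\<^sub>C x) = a *\<^sub>C cadjoint U x" for a x
    by (rule cinner_ext) (simp add: unitary_cadjoint_cinner_right cinner_scaleC_right)
  have "norm (cadjoint U x) = norm x" for x
    by (rule norm_eq_of_cinner) (rule cinner_cadjoint_unitary)
  then have "bounded_linear (cadjoint U)"
    by (intro bounded_linear_intro[where K = 1]) (simp_all add: add scale scaleR_scaleC)
  then show ?thesis
    by (simp add: bounded_clinear_def scale)
qed

lemma inj_cadjoint_unitary: "inj (cadjoint U)"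
  by (metis injI unitary_cadjoint_cancel(2))

text \<open>Trades conjugation by \<open>U\<close> for a change of basis: the quadratic form of
  \<open>U \<circ> T \<circ> cadjoint U\<close> at \<open>e\<close> is that of \<open>T\<close> at
  \<open>cadjoint U e\<close>.\<close>

lemma is_onb_cadjoint_unitary:
  assumes "is_onb B"
  shows "is_onb (cadjoint U ` B)"
proof -
  have "x = 0" if "\<forall>e\<in>B. cinner (cadjoint U e) x = 0" for x
  proof -
    have "U x = 0"
      using that by (intro is_onb_eq_zero[OF assms]) (simp add: unitary_cadjoint_cinner)
    then show "x = 0"
      using unitary_cadjoint_cancel(1)[of x] bounded_clinearD(5)[OF bounded_clinear_cadjoint_unitary]
      by simp
  qed
  then show ?thesis
    using orthonormalD[OF is_onb_orthonormal[OF assms]] inj_cadjoint_unitary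
    unfolding is_onb_def by (auto simp: cinner_cadjoint_unitary inj_eq)
qed

end


section \<open>Positive operators\<close>

lemma positive_op_cases:
  assumes "positive_op P"
  shows "bounded_clinear P" "Re (cinner x (P x)) \<ge> 0" "Im (cinner x (P x)) = 0"
  using assms unfolding positive_op_def complex_nonneg_Reals_iff by blast+

lemma positive_opI:
  "bounded_clinear P \<Longrightarrow> (\<And>x. Re (cinner x (P x)) \<ge> 0) \<Longrightarrow> (\<And>x. Im (cinner x (P x)) = 0) \<Longrightarrow> positive_op P"
  unfolding positive_op_def complex_nonneg_Reals_iff by blast

text \<open>Polarisation: reality of the form at \<open>x + y\<close> relates the imaginary parts of
  the two mixed terms, reality at \<open>x + \<i> *\<^sub>C y\<close> their real parts.\<close>

lemma positive_op_hermitian: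
  assumes "positive_op P"
  shows "cinner (P x) y = cinner x (P y)"
proof -
  note P = positive_op_cases[OF assms]
  have "Im (cinner x (P y) + cinner y (P x)) = 0"
    using P(3)[of "x + y"] P(3)[of x] P(3)[of y]
    by (simp add: bounded_clinearD[OF P(1)] cinner_add_left cinner_add_right)
  moreover have "Im (\<i> * cinner x (P y) - \<i> * cinner y (P x)) = 0"
    using P(3)[of "x + \<i> *\<^sub>C y"] P(3)[of x] P(3)[of y]
    by (simp add: bounded_clinearD[OF P(1)] cinner_add_left cinner_add_right cinner_scaleC_left
        cinner_scaleC_right)
  ultimately have "cinner x (P y) = cnj (cinner y (P x))"
    by (simp add: complex_eq_iff)
  then show ?thesis
    using cinner_commute[of "P x" y] by simp
qed

lemma nonneg_quadratic_imp_discriminant: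
  fixes p q c :: real
  assumes nonneg: "\<And>r. p + 2 * r * c + r\<^sup>2 * q \<ge> 0"
    and q: "q \<ge> 0"
  shows "c\<^sup>2 \<le> p * q"
proof (cases "q = 0")
  case True
  have "c = 0"
  proof (rule ccontr)
    assume "c \<noteq> 0"
    \<comment> \<open>At this \<open>r\<close> the polynomial, which is linear because
      \<open>q = 0\<close>, has the value -1.\<close>
    then show False
      using nonneg[of "- (p + 1) / (2 * c)"] True by (simp add: field_simps)
  qed
  then show ?thesis
    using True by simp
next
  case False
  then have "q > 0"
    using q by simp
  \<comment> \<open>The quadratic attains its minimum at \<open>- c / q\<close>.\<close>
  then show ?thesis
    using nonneg[of "- c / q"] by (simp add: field_simps power2_eq_square)
qed

lemma positive_op_Cauchy_Schwarz:
  assumes "positive_op P"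
  shows "(cmod (cinner x (P y)))\<^sup>2 \<le> Re (cinner x (P x)) * Re (cinner y (P y))"
proof (cases "cinner x (P y) = 0")
  case True
  then show ?thesis
    using positive_op_cases(2)[OF assms] by simp
next
  case False
  note P = positive_op_cases[OF assms]
  \<comment> \<open>A phase that makes the mixed term real and positive, so that a real parameter
    \<open>r\<close> yields the discriminant inequality.\<close>
  define a where "a = cnj (cinner x (P y)) / cmod (cinner x (P y))"
  have a: "cnj a * a = 1"
    using False unfolding cnj_mult_self by (simp add: a_def norm_divide)
  have ax: "a * cinner x (P y) = cmod (cinner x (P y))"
    using False complex_norm_square[of "cinner x (P y)"]
    by (simp add: a_def power2_eq_square mult.commute field_simps)
  have yx: "cinner y (P x) = cnj (cinner x (P y))"
    by (metis assms cinner_commute positive_op_hermitian)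
  have ay: "cnj a * cinner y (P x) = cmod (cinner x (P y))"
    unfolding yx complex_cnj_mult[symmetric] ax by simp
  have "0 \<le> Re (cinner x (P x)) + 2 * r * cmod (cinner x (P y)) + r\<^sup>2 * Re (cinner y (P y))" for r
  proof -
    have "cinner (x + r *\<^sub>R a *\<^sub>C y) (P (x + r *\<^sub>R a *\<^sub>C y))
        = cinner x (P x) + r *\<^sub>R (a * cinner x (P y)) + r *\<^sub>R (cnj a * cinner y (P x))
          + (r * r) *\<^sub>R ((cnj a * a) * cinner y (P y))"
      by (simp add: bounded_clinearD[OF P(1)] cinner_add_left cinner_add_right cinner_scaleC_left
        cinner_scaleC_right cinner_scaleR_left cinner_scaleR_right scaleR_conv_of_real algebra_simps)
    then show ?thesis
      using P(2)[of "x + r *\<^sub>R a *\<^sub>C y"] unfolding a ax ay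
      by (simp add: power2_eq_square)
  qed
  then show ?thesis
    using P(2) by (rule nonneg_quadratic_imp_discriminant)
qed


lemma positive_op_eq_zero:
  assumes "positive_op P" "Re (cinner x (P x)) = 0"
  shows "P x = 0"
proof -
  have "(cmod (cinner (P x) (P x)))\<^sup>2 \<le> 0"
    using positive_op_Cauchy_Schwarz[OF assms(1), of "P x" x] assms(2) by simp
  then show ?thesis
    by (simp add: cinner_self)
qed

text \<open>With \<open>w\<close> scaled by \<open>1 / sqrt q\<close>, Cauchy-Schwarz for the form
  of \<open>P\<close> says exactly that the form of \<open>|w><w|\<close> lies below that of
  \<open>P\<close>, with equality at \<open>e\<close>.\<close>

lemma positive_op_diff_rank_one:
  assumes P: "positive_op P" and q: "q = Re (cinner e (P e))" "q > 0"
    and w: "w = (1 / sqrt q) *\<^sub>R P e"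
  shows "positive_op (\<lambda>x. P x - cinner w x *\<^sub>C w)" "P e - cinner w e *\<^sub>C w = 0"
    "cinner x (P x - cinner w x *\<^sub>C w) = cinner x (P x) - (cmod (cinner w x))\<^sup>2"
proof -
  note P' = positive_op_cases[OF P]
  have form: "cinner x (P x - cinner w x *\<^sub>C w) = cinner x (P x) - (cmod (cinner w x))\<^sup>2" for x
    using cinner_commute[of x w] cnj_mult_self[of "cinner w x"]
    by (simp add: cinner_diff_right cinner_scaleC_right mult.commute)
  then show "cinner x (P x - cinner w x *\<^sub>C w) = cinner x (P x) - (cmod (cinner w x))\<^sup>2" .
  have "(cmod (cinner w x))\<^sup>2 \<le> Re (cinner x (P x))" for x
  proof -
    have "(cmod (cinner w x))\<^sup>2 = (cmod (cinner e (P x)))\<^sup>2 / q"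
      using q(2) by (simp add: w cinner_scaleR_left positive_op_hermitian[OF P] power_mult_distrib
          power_divide)
    also have "\<dots> \<le> Re (cinner x (P x))"
      using positive_op_Cauchy_Schwarz[OF P, of e x] q by (simp add: field_simps)
    finally show ?thesis .
  qed
  then show "positive_op (\<lambda>x. P x - cinner w x *\<^sub>C w)"
    by (intro positive_opI bounded_clinear_diff P' bounded_clinear_rank_one)
      (simp_all add: form P')
  have "cinner w e = sqrt q"
  proof (rule complex_eqI)
    have "cinner w e = (1 / sqrt q) *\<^sub>R cinner e (P e)"
      by (simp add: w cinner_scaleR_left positive_op_hermitian[OF P])
    then show "Re (cinner w e) = Re (sqrt q)" "Im (cinner w e) = Im (sqrt q)"
      using P'(3)[of e] q(2) by (simp_all add: q(1)[symmetric] real_div_sqrt)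
  qed
  then have "cinner w e *\<^sub>C w = sqrt q *\<^sub>R w"
    by (simp add: scaleR_scaleC)
  also have "\<dots> = P e"
    using q(2) by (simp add: w)
  finally show "P e - cinner w e *\<^sub>C w = 0"
    by simp
qed

text \<open>Each induction step is one round of Cholesky elimination: subtracting the rank one operator
  \<open>|w\<rangle>\<langle>w|\<close> keeps \<open>P\<close> positive and makes it vanish at \<open>e\<close>.\<close>

lemma sum_compression_le:
  assumes "finite E" "orthonormal E" "finite F" "orthonormal F" "positive_op P"
  shows "(\<Sum>f\<in>F. Re (cinner (\<Sum>e\<in>E. cinner e f *\<^sub>C e) (P (\<Sum>e\<in>E. cinner e f *\<^sub>C e))))
    \<le> (\<Sum>e\<in>E. Re (cinner e (P e)))"
  using assms(1,2,5)
proof (induction E arbitrary: P rule: finite_induct)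
  case empty
  then show ?case
    by simp
next
  case (insert e0 E)
  let ?p = "\<lambda>f. \<Sum>e\<in>E. cinner e f *\<^sub>C e"
  let ?p' = "\<lambda>f. \<Sum>e\<in>insert e0 E. cinner e f *\<^sub>C e"
  have p': "?p' f = cinner e0 f *\<^sub>C e0 + ?p f" for f
    using insert by simp
  have E: "orthonormal E"
    using insert.prems(1) by (rule orthonormal_subset) auto
  \<comment> \<open>\<open>Q\<close> kills \<open>e0\<close> and, being Hermitian, has range
    orthogonal to \<open>e0\<close>. The \<open>e0\<close> component therefore drops out and the
    induction hypothesis for \<open>E\<close> applies.\<close>
  have reduce: "cinner (?p' f) (Q (?p' f)) = cinner (?p f) (Q (?p f))"
    if Q: "positive_op Q" "Q e0 = 0" for Q f
  proof -
    have "Q (?p' f) = Q (?p f)"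
      unfolding p' using Q by (simp add: bounded_clinearD[OF positive_op_cases(1)[OF Q(1)]])
    moreover have "cinner e0 (Q z) = 0" for z
      using positive_op_hermitian[OF Q(1), of e0 z] Q(2) by simp
    ultimately show ?thesis
      unfolding p' by (simp add: cinner_add_left cinner_scaleC_left)
  qed
  show ?case
  proof (cases "Re (cinner e0 (P e0)) = 0")
    case True
    have "P e0 = 0"
      using positive_op_eq_zero[OF insert.prems(2) True] .
    then show ?thesis
      unfolding reduce[OF insert.prems(2) \<open>P e0 = 0\<close>]
      using insert.IH[OF E insert.prems(2)] insert.hyps by simp
  next
    case False
    define q where "q = Re (cinner e0 (P e0))"
    define w where "w = (1 / sqrt q) *\<^sub>R P e0"
    define Q where "Q = (\<lambda>x. P x - cinner w x *\<^sub>C w)"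
    have q: "q > 0"
      using False positive_op_cases(2)[OF insert.prems(2), of e0] by (simp add: q_def)
    note rank_one = positive_op_diff_rank_one[OF insert.prems(2) q_def q w_def]
    have Q: "positive_op Q" "Q e0 = 0"
      using rank_one(1,2) by (simp_all add: Q_def)
    have split: "Re (cinner x (P x)) = Re (cinner x (Q x)) + (cmod (cinner w x))\<^sup>2" for x
      using rank_one(3)[of x] by (simp add: Q_def)
    \<comment> \<open>The projection \<open>?p'\<close> is self-adjoint and can be moved onto
      \<open>w\<close>; Bessel then disposes of \<open>F\<close>, and Pythagoras evaluates the norm
      along \<open>insert e0 E\<close>.\<close>
    have "(\<Sum>f\<in>F. (cmod (cinner w (?p' f)))\<^sup>2) = (\<Sum>f\<in>F. (cmod (cinner f (?p' w)))\<^sup>2)"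
    proof (rule sum.cong[OF refl])
      fix f
      have "cinner w (?p' f) = cnj (cinner f (?p' w))"
        unfolding cinner_sum_right cinner_scaleC_right cnj_sum complex_cnj_mult
          cinner_commute[of w] cinner_commute[of f, symmetric]
        by (intro sum.cong refl) (metis cinner_commute mult.commute)
      then show "(cmod (cinner w (?p' f)))\<^sup>2 = (cmod (cinner f (?p' w)))\<^sup>2"
        by (simp only: complex_mod_cnj)
    qed
    also have "\<dots> \<le> (norm (?p' w))\<^sup>2"
      using assms(3,4) by (intro Bessel)
    also have "\<dots> = (\<Sum>e\<in>insert e0 E. (cmod (cinner e w))\<^sup>2)"
      using insert.hyps(1) by (intro norm_sum_orthonormal[OF insert.prems(1)]) auto
    also have "\<dots> = (\<Sum>e\<in>insert e0 E. (cmod (cinner w e))\<^sup>2)"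
      by (intro sum.cong refl) (metis cinner_commute complex_mod_cnj)
    finally have w_part: "(\<Sum>f\<in>F. (cmod (cinner w (?p' f)))\<^sup>2)
      \<le> (\<Sum>e\<in>insert e0 E. (cmod (cinner w e))\<^sup>2)" .
    have "(\<Sum>f\<in>F. Re (cinner (?p' f) (Q (?p' f)))) \<le> (\<Sum>e\<in>E. Re (cinner e (Q e)))"
      unfolding reduce[OF Q] by (rule insert.IH[OF E Q(1)])
    also have "\<dots> = (\<Sum>e\<in>insert e0 E. Re (cinner e (Q e)))"
      using insert.hyps Q(2) by simp
    finally show ?thesis
      using w_part unfolding split sum.distrib by linarith
  qed
qed

text \<open>The vectors of \<open>F\<close> are limits of their projections onto finite parts
  \<open>E\<close> of \<open>B\<close>. For each \<open>E\<close> the bound is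
  \<open>sum_compression_le\<close>, and it survives the limit because \<open>P\<close> is
  continuous.\<close>

lemma positive_op_trace_le:
  fixes P :: "'a::chilbert_space \<Rightarrow> 'a"
  assumes P: "positive_op P" and B: "is_onb B"
    and summ: "(\<lambda>e. Re (cinner e (P e))) summable_on B"
    and F: "finite F" "orthonormal F"
  shows "(\<Sum>f\<in>F. Re (cinner f (P f))) \<le> (\<Sum>\<^sub>\<infinity>e\<in>B. Re (cinner e (P e)))"
proof (rule tendsto_upperbound)
  let ?p = "\<lambda>E f. \<Sum>e\<in>E. cinner e f *\<^sub>C e"
  have lim: "((\<lambda>E. ?p E f) \<longlongrightarrow> f) (finite_subsets_at_top B)" for f
    using onb_expansion[OF B, of f] unfolding has_sum_def .
  show "((\<lambda>E. \<Sum>f\<in>F. Re (cinner (?p E f) (P (?p E f)))) \<longlongrightarrow> (\<Sum>f\<in>F. Re (cinner f (P f))))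
      (finite_subsets_at_top B)"
    unfolding Re_cinner
    by (intro tendsto_sum tendsto_inner lim bounded_linear.tendsto[OF
          bounded_clinearD(1)[OF positive_op_cases(1)[OF P]]])
  show "\<forall>\<^sub>F E in finite_subsets_at_top B. (\<Sum>f\<in>F. Re (cinner (?p E f) (P (?p E f))))
      \<le> (\<Sum>\<^sub>\<infinity>e\<in>B. Re (cinner e (P e)))"
  proof (rule eventually_finite_subsets_at_top_weakI)
    fix E
    assume E: "finite E" "E \<subseteq> B"
    have "(\<Sum>f\<in>F. Re (cinner (?p E f) (P (?p E f)))) \<le> (\<Sum>e\<in>E. Re (cinner e (P e)))"
      using E F P orthonormal_subset[OF is_onb_orthonormal[OF B] E(2)]
      by (intro sum_compression_le)
    also have "\<dots> \<le> (\<Sum>\<^sub>\<infinity>e\<in>B. Re (cinner e (P e)))"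
      using E by (intro finite_sum_le_infsum summ positive_op_cases(2)[OF P])
    finally show "(\<Sum>f\<in>F. Re (cinner (?p E f) (P (?p E f))))
      \<le> (\<Sum>\<^sub>\<infinity>e\<in>B. Re (cinner e (P e)))" .
  qed
qed simp

text \<open>The preceding inequality, with finite parts of the other basis as \<open>F\<close>,
  applies in both directions, so the two sums bound each other.\<close>

lemma positive_op_trace_onb_indep:
  fixes P :: "'a::chilbert_space \<Rightarrow> 'a"
  assumes P: "positive_op P" and B: "is_onb B" and C: "is_onb C"
    and summ: "(\<lambda>e. cinner e (P e)) summable_on B"
  shows "(\<lambda>e. cinner e (P e)) summable_on C"
    "(\<Sum>\<^sub>\<infinity>e\<in>C. cinner e (P e)) = (\<Sum>\<^sub>\<infinity>e\<in>B. cinner e (P e))"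
proof -
  let ?r = "\<lambda>e. Re (cinner e (P e))"
  have of_real: "cinner e (P e) = complex_of_real (?r e)" for e
    using positive_op_cases(3)[OF P] by (simp add: complex_eq_iff)
  have le: "?r summable_on Y \<and> infsum ?r Y \<le> infsum ?r X"
    if X: "is_onb X" "?r summable_on X" and Y: "is_onb Y" for X Y
  proof -
    have bound: "sum ?r F \<le> infsum ?r X" if "finite F" "F \<subseteq> Y" for F
      using positive_op_trace_le[OF P X] that orthonormal_subset[OF is_onb_orthonormal[OF Y]] by blast
    then have "?r summable_on Y"
      by (intro nonneg_bdd_above_summable_on positive_op_cases(2)[OF P] bdd_aboveI2) auto
    then show ?thesis
      using bound by (auto intro: infsum_le_finite_sums)
  qed
  have "?r summable_on B"
    using summ by (rule summable_on_Re)
  have *: "?r summable_on C" "infsum ?r C = infsum ?r B"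
    using le[OF B \<open>?r summable_on B\<close> C] le[OF C _ B] by auto
  have conv: "((\<lambda>e. cinner e (P e)) has_sum of_real (infsum ?r X)) X"
    if "?r summable_on X" for X
  proof -
    have eq: "(\<lambda>e. cinner e (P e)) = (\<lambda>e. complex_of_real (?r e))"
      by (rule ext) (rule of_real)
    show ?thesis
      by (subst eq) (rule has_sum_of_real[OF has_sum_infsum[OF that]])
  qed
  show "(\<lambda>e. cinner e (P e)) summable_on C"
    using conv[OF *(1)] summable_on_def by blast
  show "(\<Sum>\<^sub>\<infinity>e\<in>C. cinner e (P e)) = (\<Sum>\<^sub>\<infinity>e\<in>B. cinner e (P e))"
    using infsumI[OF conv[OF *(1)]] infsumI[OF conv[OF \<open>?r summable_on B\<close>]] *(2) by simp
qed

text \<open>If \<open>P + A\<close> had a negative lower bound \<open>m\<close>, an approximate eigenvector \<open>x\<close> for \<open>m\<close> would satisfy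
  \<open>A x \<approx> m x - P x\<close>, hence \<open>\<parallel>A x\<parallel>\<^sup>2 \<ge> \<parallel>P x\<parallel>\<^sup>2 + m\<^sup>2\<close> approximately.\<close>

lemma positive_op_add_hermitian:
  fixes A P :: "'a::complex_inner \<Rightarrow> 'a"
  assumes A: "hermitian_op A" and P: "positive_op P" and eq: "\<And>x. norm (A x) = norm (P x)"
  shows "positive_op (\<lambda>x. P x + A x)"
proof -
  note P' = positive_op_cases[OF P]
  have A': "bounded_clinear A" "\<And>x y. cinner (A x) y = cinner x (A y)"
    using A by (auto simp: hermitian_op_def)
  define B where "B = (\<lambda>x. P x + A x)"
  have B: "bounded_clinear B"
    unfolding B_def by (intro bounded_clinear_add P' A')
  have "cinner x (A x) = cnj (cinner x (A x))" for x
    by (metis A'(2) cinner_commute)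
  then have "Im (cinner x (A x)) = 0" for x
    by (metis cnj.sel(2) equal_neg_zero)
  then have Im_B: "Im (cinner x (B x)) = 0" for x
    by (simp add: B_def cinner_add_right P')
  have Re_scale: "Re (cinner (r *\<^sub>R x) (B (r *\<^sub>R x))) = r\<^sup>2 * Re (cinner x (B x))" for r x
    by (simp add: bounded_clinearD[OF B] cinner_scaleR_left cinner_scaleR_right power2_eq_square)
  obtain K where K: "K > 0" "\<And>x. norm (P x) \<le> norm x * K"
    using bounded_linear.pos_bounded[OF bounded_clinearD(1)[OF P'(1)]] by blast
  obtain KB where KB: "KB > 0" "\<And>x. norm (B x) \<le> norm x * KB"
    using bounded_linear.pos_bounded[OF bounded_clinearD(1)[OF B]] by blast
  have "Re (cinner x (B x)) \<ge> 0" for x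
  proof (rule ccontr)
    assume neg: "\<not> Re (cinner x (B x)) \<ge> 0"
    define S where "S = (\<lambda>x. Re (cinner x (B x))) ` {x. norm x = 1}"
    have "x \<noteq> 0"
      using neg by auto
    define y where "y = (1 / norm x) *\<^sub>R x"
    have y: "norm y = 1" "Re (cinner y (B y)) < 0"
      using neg \<open>x \<noteq> 0\<close> unfolding y_def Re_scale by (auto simp: field_simps)
    have bdd: "bdd_below S"
      unfolding S_def
    proof (rule bdd_belowI2)
      fix z :: 'a
      assume "z \<in> {x. norm x = 1}"
      then have "cmod (cinner z (B z)) \<le> KB"
        using norm_cinner_le[of z "B z"] KB(2)[of z] by simp
      then show "- KB \<le> Re (cinner z (B z))"
        using abs_Re_le_cmod[of "cinner z (B z)"] by linarith
    qed
    define m where "m = Inf S"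
    have "m < 0"
      using cInf_lower[OF _ bdd, of "Re (cinner y (B y))"] y by (auto simp: S_def m_def)
    have m_le: "m * (norm z)\<^sup>2 \<le> Re (cinner z (B z))" for z
    proof (cases "z = 0")
      case False
      have "m \<le> Re (cinner ((1 / norm z) *\<^sub>R z) (B ((1 / norm z) *\<^sub>R z)))"
        unfolding m_def using False by (intro cInf_lower bdd) (auto simp: S_def)
      then show ?thesis
        using False unfolding Re_scale by (simp add: field_simps)
    qed (simp add: bounded_clinearD[OF B])
    define C where "C = (\<lambda>x. B x - complex_of_real m *\<^sub>C x)"
    have C_form: "cinner z (C z) = cinner z (B z) - complex_of_real (m * (norm z)\<^sup>2)" for z
      by (simp add: C_def cinner_diff_right cinner_scaleC_right cinner_self)
    have C: "positive_op C"
    proof (rule positive_opI)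
      have "bounded_clinear (\<lambda>x :: 'a. x)"
        by (simp add: bounded_clinear_def bounded_linear_ident)
      then show "bounded_clinear C"
        unfolding C_def by (intro bounded_clinear_diff B bounded_clinear_scaleC)
    qed (simp_all add: C_form Im_B m_le del: of_real_mult)
    obtain KC where KC: "KC > 0" "\<And>x. norm (C x) \<le> norm x * KC"
      using bounded_linear.pos_bounded[OF bounded_clinearD(1)[OF positive_op_cases(1)[OF C]]]
      by blast
    \<comment> \<open>Cauchy-Schwarz for the form of \<open>C\<close> at the pair
      \<open>C z\<close>, \<open>z\<close>. It turns a small form value into a small norm of
      \<open>C z\<close>, so near-minimisers of the form of \<open>B\<close> are approximate
      eigenvectors for \<open>m\<close>.\<close>
    have C_le: "(norm (C z))\<^sup>2 \<le> KC * Re (cinner z (C z))" for z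
    proof (cases "C z = 0")
      case True
      then show ?thesis
        using KC(1) positive_op_cases(2)[OF C, of z] by simp
    next
      case False
      let ?n = "(norm (C z))\<^sup>2"
      have "?n * ?n = (cmod (cinner (C z) (C z)))\<^sup>2"
        by (simp add: cinner_self norm_mult power2_eq_square)
      also have "\<dots> \<le> Re (cinner (C z) (C (C z))) * Re (cinner z (C z))"
        by (rule positive_op_Cauchy_Schwarz[OF C])
      also have "Re (cinner (C z) (C (C z))) \<le> ?n * KC"
        using complex_Re_le_cmod[of "cinner (C z) (C (C z))"] norm_cinner_le[of "C z" "C (C z)"]
          mult_left_mono[OF KC(2)[of "C z"], of "norm (C z)"]
        by (simp add: power2_eq_square)
      finally have "?n * ?n \<le> ?n * (KC * Re (cinner z (C z)))"
        using positive_op_cases(2)[OF C, of z] by (simp add: mult_right_mono mult.assoc)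
      then show ?thesis
        using False by (simp only: mult_le_cancel_left) simp
    qed
    \<comment> \<open>The admissible size of \<open>C z\<close>: since \<open>\<eta> \<le> 1\<close>
      gives \<open>\<eta>\<^sup>2 \<le> \<eta>\<close>, the total error
      \<open>2 * K * \<eta> + \<eta>\<^sup>2\<close> is at most
      \<open>m\<^sup>2 / 2\<close>.\<close>
    define \<eta> where "\<eta> = min 1 (m\<^sup>2 / 2 / (2 * K + 1))"
    have \<eta>: "0 < \<eta>" "\<eta> \<le> 1"
      using \<open>m < 0\<close> K(1) by (simp_all add: \<eta>_def)
    have "(2 * K + 1) * \<eta> \<le> (2 * K + 1) * (m\<^sup>2 / 2 / (2 * K + 1))"
      using K(1) by (intro mult_left_mono) (simp_all add: \<eta>_def)
    also have "\<dots> = m\<^sup>2 / 2"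
      using K(1) by (simp add: field_simps)
    finally have \<eta>_small: "(2 * K + 1) * \<eta> \<le> m\<^sup>2 / 2" .
    \<comment> \<open>The excess \<open>\<eta>\<^sup>2 / KC\<close> over the infimum is what
      \<open>C_le\<close> converts into \<open>norm (C z) \<le> \<eta>\<close>.\<close>
    have "Inf S < m + \<eta>\<^sup>2 / KC"
      using \<eta>(1) KC(1) by (simp add: m_def)
    then obtain z where z: "norm z = 1" "Re (cinner z (B z)) < m + \<eta>\<^sup>2 / KC"
      using y(1) by (subst (asm) cInf_less_iff[OF _ bdd]) (auto simp: S_def)
    have "(norm (C z))\<^sup>2 \<le> KC * (Re (cinner z (B z)) - m)"
      using C_le[of z] z(1) by (simp add: C_form)
    also have "\<dots> \<le> \<eta>\<^sup>2"
      using z(2) KC(1) by (simp add: field_simps)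
    finally have Cz: "norm (C z) \<le> \<eta>"
      using \<eta>(1) by (simp add: power2_le_iff_abs_le)
    have "P z - m *\<^sub>R z = C z - A z"
      by (simp add: C_def B_def scaleR_scaleC)
    then have "norm (P z - m *\<^sub>R z) \<le> norm (P z) + norm (C z)"
      using norm_triangle_ineq4[of "C z" "A z"] eq[of z] by simp
    then have "(norm (P z - m *\<^sub>R z))\<^sup>2 \<le> (norm (P z) + norm (C z))\<^sup>2"
      by (simp add: power_mono)
    moreover have "(norm (P z - m *\<^sub>R z))\<^sup>2 = (norm (P z))\<^sup>2 - 2 * m * Re (cinner z (P z)) + m\<^sup>2"
    proof -
      have "inner z z = 1"
        using z(1) by (simp add: dot_square_norm)
      then show ?thesis
        unfolding power2_norm_eq_inner Re_cinner
        by (simp add: inner_diff_left inner_diff_right inner_commute power2_eq_square algebra_simps)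
    qed
    moreover have "m * Re (cinner z (P z)) \<le> 0"
      using \<open>m < 0\<close> P'(2)[of z] by (simp add: mult_nonpos_nonneg)
    \<comment> \<open>The squares of \<open>norm (P z)\<close> cancel, and the mixed term
      \<open>- 2 * m * Re (cinner z (P z))\<close> has the favourable sign because \<open>m\<close>
      is negative.\<close>
    ultimately have "m\<^sup>2 \<le> 2 * norm (P z) * norm (C z) + norm (C z) * norm (C z)"
      by (simp add: power2_eq_square algebra_simps)
    also have "\<dots> \<le> 2 * K * \<eta> + 1 * \<eta>"
    proof (rule add_mono)
      show "2 * norm (P z) * norm (C z) \<le> 2 * K * \<eta>"
        using K z(1) K(2)[of z] Cz by (intro mult_mono) auto
      show "norm (C z) * norm (C z) \<le> 1 * \<eta>"
        using Cz \<eta> by (intro mult_mono) auto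
    qed
    also have "\<dots> \<le> m\<^sup>2 / 2"
      using \<eta>_small by (simp add: algebra_simps)
    finally show False
      using \<open>m < 0\<close> by simp
  qed
  then show ?thesis
    using B Im_B unfolding B_def by (intro positive_opI)
qed


section \<open>Operators of finite trace\<close>

text \<open>Mathematically the trace class again, but presented for induction: a property linear in
  the operator has to be checked only for positive ones. Each positive generator may come with its
  own basis, as \<open>positive_op_trace_onb_indep\<close> allows switching to any other.\<close>

inductive trace_span :: "('a::chilbert_space \<Rightarrow> 'a) \<Rightarrow> bool" where
  positive: "positive_op P \<Longrightarrow> is_onb B \<Longrightarrow> (\<lambda>e. cinner e (P e)) summable_on B \<Longrightarrow> trace_span P"
| add: "trace_span S \<Longrightarrow> trace_span T \<Longrightarrow> trace_span (\<lambda>x. S x + T x)"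
| scaleC: "trace_span T \<Longrightarrow> trace_span (\<lambda>x. c *\<^sub>C T x)"

lemma bounded_clinear_zero: "bounded_clinear (\<lambda>x. 0)"
  by (simp add: bounded_clinear_def bounded_linear_zero)

lemma trace_span_zero: "trace_span (\<lambda>x. 0)"
  by (rule trace_span.positive[OF _ some_onb]) (auto intro!: positive_opI bounded_clinear_zero)

lemma trace_span_sum: "(\<And>i. i \<in> I \<Longrightarrow> trace_span (T i)) \<Longrightarrow> trace_span (\<lambda>x. \<Sum>i\<in>I. T i x)"
  by (induction I rule: infinite_finite_induct)
    (auto intro: trace_span_zero trace_span.add)

text \<open>For Hermitian \<open>T\<close> the equation for \<open>P\<close> becomes
  \<open>P (P x) = T (T x)\<close>, so \<open>norm (T x) = norm (P x)\<close>, which is what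
  \<open>positive_op_add_hermitian\<close> asks for. The two parts of
  \<open>T = ((P + T) - (P - T)) / 2\<close> have finite trace because they lie between 0 and
  \<open>2 P\<close>.\<close>

lemma trace_span_if_trace_class:
  fixes T :: "'a::chilbert_space \<Rightarrow> 'a"
  assumes T: "hermitian_op T" and "trace_class T"
  shows "trace_span T"
proof -
  obtain P B where P: "positive_op P" and PP: "P \<circ> P = cadjoint T \<circ> T" and B: "is_onb B"
    and summ: "(\<lambda>e. cinner e (P e)) summable_on B"
    using assms unfolding trace_class_def by blast
  have T': "bounded_clinear T" "\<And>x y. cinner (T x) y = cinner x (T y)"
    using T by (auto simp: hermitian_op_def)
  have "cadjoint T = T"
    by (rule cadjoint_eqI) (rule T'(2))
  then have "P (P x) = T (T x)" for x
    using PP by (metis comp_apply)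
  then have eq: "norm (T x) = norm (P x)" for x
    by (intro norm_eq_of_cinner) (simp add: T'(2) positive_op_hermitian[OF P])
  have neg: "hermitian_op (\<lambda>x. - T x)"
    using T'(2) bounded_clinear_scaleC[OF T'(1), of "-1"]
    by (simp add: hermitian_op_def cinner_minus_left cinner_minus_right scaleC_minus_left)
  \<comment> \<open>Stated for general \<open>A\<close> to serve both \<open>T\<close> and
    \<open>- T\<close>; the upper bound on \<open>P + A\<close> is the positivity of
    \<open>P - A\<close>.\<close>
  have span: "trace_span (\<lambda>x. P x + A x)"
    if A: "hermitian_op A" "\<And>x. norm (A x) = norm (P x)" for A
  proof (rule trace_span.positive[OF positive_op_add_hermitian[OF A(1) P A(2)] B])
    have pos: "Re (cinner x (P x + A x)) \<ge> 0" "Im (cinner x (P x + A x)) = 0" for x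
      using positive_op_cases[OF positive_op_add_hermitian[OF A(1) P A(2)]] by blast+
    have "hermitian_op (\<lambda>x. - A x)" "\<And>x. norm (- A x) = norm (P x)"
      using A bounded_clinear_scaleC[of A "-1"]
      by (simp_all add: hermitian_op_def cinner_minus_left cinner_minus_right scaleC_minus_left)
    note neg_pos = positive_op_cases(2)[OF positive_op_add_hermitian[OF this(1) P this(2)]]
    have le: "Re (cinner x (P x + A x)) \<le> 2 * Re (cinner x (P x))" for x
      using neg_pos[of x] by (simp add: cinner_add_right cinner_diff_right)
    show "(\<lambda>x. cinner x (P x + A x)) summable_on B"
    proof (rule abs_summable_summable, rule summable_on_comparison_test)
      show "(\<lambda>x. 2 * Re (cinner x (P x))) summable_on B"
        using summ by (intro summable_on_cmult_right summable_on_Re)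
      show "norm (cinner x (P x + A x)) \<le> 2 * Re (cinner x (P x))" for x
        using le[of x] pos[of x] by (simp add: cmod_eq_Re)
    qed simp
  qed
  have "trace_span (\<lambda>x. (1/2) *\<^sub>C ((P x + T x) + (-1) *\<^sub>C (P x + - T x)))"
    by (intro trace_span.scaleC trace_span.add span T neg) (simp_all add: eq)
  moreover have "(1/2) *\<^sub>C ((P x + T x) + (-1) *\<^sub>C (P x + - T x)) = T x" for x
  proof -
    have "(P x + T x) + (-1) *\<^sub>C (P x + - T x) = 2 *\<^sub>C T x"
      using scaleC_add_left[of 1 1 "T x"] by (simp add: scaleC_minus_left)
    then show ?thesis
      by (simp add: scaleC_scaleC)
  qed
  ultimately show ?thesis
    by simp
qed

text \<open>In the positive case the diagonal of the conjugate along \<open>some_onb\<close> is the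
  diagonal of \<open>P\<close> along the rotated basis, where basis independence gives
  convergence.\<close>

lemma trace_span_unitary_conj:
  assumes U: "unitary_op U" and "trace_span T"
  shows "trace_span (U \<circ> T \<circ> cadjoint U)"
  using assms(2)
proof induction
  case (positive P B)
  note P = positive_op_cases[OF positive(1)]
  have form: "cinner x ((U \<circ> P \<circ> cadjoint U) x) = cinner (cadjoint U x) (P (cadjoint U x))" for x
    by (simp add: unitary_cadjoint_cinner[OF U])
  show ?case
  proof (rule trace_span.positive[OF _ some_onb])
    show "positive_op (U \<circ> P \<circ> cadjoint U)"
      by (rule positive_opI)
        (auto simp: form P simp del: o_apply intro!: bounded_clinear_comp P(1) bounded_clinear_unitary[OF U]
          bounded_clinear_cadjoint_unitary[OF U])
    have "(\<lambda>e. cinner e (P e)) summable_on cadjoint U ` some_onb"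
      by (rule positive_op_trace_onb_indep(1)[OF positive(1,2) _ positive(3)])
        (rule is_onb_cadjoint_unitary[OF U some_onb])
    then show "(\<lambda>x. cinner x ((U \<circ> P \<circ> cadjoint U) x)) summable_on some_onb"
      unfolding form
      by (subst (asm) summable_on_reindex)
        (auto intro: inj_on_subset[OF inj_cadjoint_unitary[OF U]] simp: o_def)
  qed
next
  case (add S T)
  have "U \<circ> (\<lambda>x. S x + T x) \<circ> cadjoint U
      = (\<lambda>x. (U \<circ> S \<circ> cadjoint U) x + (U \<circ> T \<circ> cadjoint U) x)"
    by (simp add: fun_eq_iff bounded_clinearD[OF bounded_clinear_unitary[OF U]])
  then show ?case
    using trace_span.add[OF add.IH] by (simp only:)
next
  case (scaleC T c)
  have "U \<circ> (\<lambda>x. c *\<^sub>C T x) \<circ> cadjoint U = (\<lambda>x. c *\<^sub>C (U \<circ> T \<circ> cadjoint U) x)"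
    by (simp add: fun_eq_iff bounded_clinearD[OF bounded_clinear_unitary[OF U]])
  then show ?case
    using trace_span.scaleC[OF scaleC.IH] by (simp only:)
qed

section \<open>Tensor products and partial traces\<close>

lemma bounded_linear_componentwise:
  fixes f :: "'a::real_normed_vector \<Rightarrow> 'b::real_normed_vector ^ 'n"
  assumes "\<And>i. bounded_linear (\<lambda>x. f x $ i)"
  shows "bounded_linear f"
proof -
  have "\<forall>i. \<exists>K. \<forall>x. norm (f x $ i) \<le> norm x * K"
    using bounded_linear.bounded[OF assms] by blast
  then obtain K where K: "\<And>i x. norm (f x $ i) \<le> norm x * K i"
    by metis
  show ?thesis
  proof (rule bounded_linear_intro)
    show "f (x + y) = f x + f y" "f (r *\<^sub>R x) = r *\<^sub>R f x" for x y r
      by (simp_all add: vec_eq_iff linear_add[OF bounded_linear.linear[OF assms]]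
          linear_scale[OF bounded_linear.linear[OF assms]])
    fix x
    have "norm (f x) \<le> (\<Sum>i\<in>UNIV. norm (f x $ i))"
      unfolding norm_vec_def by (rule L2_set_le_sum) simp
    also have "\<dots> \<le> norm x * (\<Sum>i\<in>UNIV. K i)"
      unfolding sum_distrib_left by (intro sum_mono K)
    finally show "norm (f x) \<le> norm x * (\<Sum>i\<in>UNIV. K i)" .
  qed
qed

lemma scaleC_vec_nth [simp]: "(a *\<^sub>C v) $ i = a *\<^sub>C v $ i"
  by (simp add: scaleC_vec_def)

lemma scaleC_complex [simp]: "a *\<^sub>C z = a * z" for z :: complex
  by (simp add: scaleC_complex_def)

lemma bounded_clinear_tensor_op:
  assumes R: "bounded_clinear R"
  shows "bounded_clinear (tensor_op X R)"
proof -
  have "bounded_linear (tensor_op X R)"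
  proof (rule bounded_linear_componentwise)
    show "bounded_linear (\<lambda>v. tensor_op X R v $ i)" for i
      unfolding tensor_op_def vec_lambda_beta
      by (intro bounded_linear_sum bounded_linear_compose[OF bounded_linear_scaleC_right]
          bounded_linear_compose[OF bounded_clinearD(1)[OF R]] bounded_linear_vec_nth)
  qed
  then show ?thesis
    by (simp add: bounded_clinear_def tensor_op_def vec_eq_iff bounded_clinearD[OF R] scaleC_scaleC
        scaleC_sum_right mult.commute)
qed

lemma cinner_tensor_op:
  "cinner w (tensor_op X R v) = (\<Sum>i\<in>UNIV. \<Sum>j\<in>UNIV. X $ i $ j * cinner (w $ i) (R (v $ j)))"
  by (simp add: cinner_vec_def tensor_op_def cinner_sum_right cinner_scaleC_right)

lemma tensor_op_add: "tensor_op (X + Y) R = (\<lambda>v. tensor_op X R v + tensor_op Y R v)"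
  by (simp add: fun_eq_iff tensor_op_def vec_eq_iff scaleC_add_left sum.distrib)

lemma tensor_op_scaleC: "tensor_op (c *\<^sub>C X) R = (\<lambda>v. c *\<^sub>C tensor_op X R v)"
  by (simp add: fun_eq_iff tensor_op_def vec_eq_iff scaleC_sum_right scaleC_scaleC)

lemma tensor_op_sum:
  "finite I \<Longrightarrow> tensor_op (\<Sum>i\<in>I. X i) R = (\<lambda>v. \<Sum>i\<in>I. tensor_op (X i) R v)"
proof (induction I rule: finite_induct)
  case empty
  show ?case
    by (simp add: fun_eq_iff tensor_op_def vec_eq_iff)
next
  case (insert i I)
  then show ?case
    by (simp add: tensor_op_add)
qed

lemma tensor_op_mdagger:
  assumes "\<And>x y. cinner (R x) y = cinner x (R y)"
  shows "cinner (tensor_op (mdagger X) R v) w = cinner v (tensor_op X R w)"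
proof -
  have "cinner (tensor_op (mdagger X) R v) w = cnj (cinner w (tensor_op (mdagger X) R v))"
    by (rule cinner_commute)
  also have "\<dots> = (\<Sum>i\<in>UNIV. \<Sum>j\<in>UNIV. X $ j $ i * cinner (v $ j) (R (w $ i)))"
    unfolding cinner_tensor_op cnj_sum complex_cnj_mult cinner_commute[symmetric]
    by (simp add: mdagger_def assms)
  also have "\<dots> = cinner v (tensor_op X R w)"
    unfolding cinner_tensor_op by (rule sum.swap)
  finally show ?thesis .
qed

text \<open>The vector on the right is the contraction of \<open>v\<close> with \<open>u\<close>;
  this form shows that positivity of \<open>R\<close> is inherited by its product with
  \<open>ketbra u u\<close>.\<close>

lemma cinner_tensor_op_ketbra:
  assumes R: "bounded_clinear R"
  shows "cinner v (tensor_op (ketbra u u) R v) =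
    cinner (\<Sum>j\<in>UNIV. cnj (u $ j) *\<^sub>C v $ j) (R (\<Sum>j\<in>UNIV. cnj (u $ j) *\<^sub>C v $ j))"
  by (simp add: cinner_tensor_op ketbra_def bounded_clinearD[OF R] cinner_sum_left cinner_sum_right
      cinner_scaleC_left cinner_scaleC_right sum_distrib_left mult_ac) (rule sum.swap)

lemma positive_op_tensor_ketbra:
  assumes "positive_op R"
  shows "positive_op (tensor_op (ketbra u u) R)"
proof -
  note R = positive_op_cases[OF assms]
  show ?thesis
    by (intro positive_opI bounded_clinear_tensor_op R(1))
      (simp_all only: cinner_tensor_op_ketbra[OF R(1)] R)
qed

section \<open>The product basis and sums along it\<close>

lemma cinner_axis_axis: "cinner (axis i (1::complex)) (axis j 1) = (if i = j then 1 else 0)"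
proof -
  have "cinner (axis i (1::complex)) (axis j 1) = (\<Sum>k\<in>UNIV. if k = i then (if i = j then 1 else 0) else 0)"
    unfolding cinner_vec_def by (intro sum.cong refl) (auto simp: axis_def cinner_complex_def)
  then show ?thesis
    by simp
qed

lemma cinner_tensor_axis: "cinner (tensor_vec (axis i 1) e) v = cinner e (v $ i)"
proof -
  have "cinner (tensor_vec (axis i 1) e) v = (\<Sum>k\<in>UNIV. if k = i then cinner e (v $ i) else 0)"
    unfolding cinner_vec_def tensor_vec_def by (intro sum.cong refl) (auto simp: axis_def)
  then show ?thesis
    by simp
qed

text \<open>The basis along which the diagonal entries of \<open>ptrace_E\<close> are summed; in it
  the trace of a partial trace is a full trace.\<close>

definition product_onb :: "('e::chilbert_space ^ 'n) set" where
  "product_onb = (\<lambda>(i, e). tensor_vec (axis i 1) e) ` (UNIV \<times> some_onb)"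

lemma some_onb_cinner:
  "e \<in> some_onb \<Longrightarrow> f \<in> some_onb \<Longrightarrow> cinner e f = (if e = f then 1 else 0)"
  using orthonormalD[OF is_onb_orthonormal[OF some_onb]] .

lemma inj_on_product_onb:
  "inj_on (\<lambda>(i, e). tensor_vec (axis i 1) e :: 'e::chilbert_space ^ 'n) (UNIV \<times> some_onb)"
proof (rule inj_onI, clarify)
  fix i j :: 'n and e f :: 'e
  assume e: "e \<in> some_onb" "f \<in> some_onb"
    and eq: "tensor_vec (axis i 1) e = (tensor_vec (axis j 1) f :: 'e ^ 'n)"
  have "cinner (tensor_vec (axis i 1) e) (tensor_vec (axis i 1) e) = (1::complex)"
    using e by (simp add: cinner_tensor_vec cinner_axis_axis some_onb_cinner)
  then have "cinner (tensor_vec (axis i 1) e) (tensor_vec (axis j 1) f :: 'e ^ 'n) = (1::complex)"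
    using eq by simp
  then show "i = j \<and> e = f"
    using e by (simp add: cinner_tensor_vec cinner_axis_axis some_onb_cinner split: if_splits)
qed

lemma is_onb_product_onb: "is_onb (product_onb :: ('e::chilbert_space ^ 'n) set)"
  unfolding is_onb_def
proof (intro conjI ballI allI impI)
  fix v w :: "'e ^ 'n"
  assume vw: "v \<in> product_onb" "w \<in> product_onb"
  obtain i e where v: "v = tensor_vec (axis i 1) e" "e \<in> some_onb"
    using vw(1) by (auto simp: product_onb_def)
  obtain j f where w: "w = tensor_vec (axis j 1) f" "f \<in> some_onb"
    using vw(2) by (auto simp: product_onb_def)
  have "v = w \<longleftrightarrow> i = j \<and> e = f"
    using inj_on_product_onb[THEN inj_onD, of "(i, e)" "(j, f)"] v w by auto
  then show "cinner v w = (if v = w then 1 else 0)"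
    using v(2) w(2) unfolding v(1) w(1)
    by (simp add: cinner_tensor_vec cinner_axis_axis some_onb_cinner)
next
  fix v :: "'e ^ 'n"
  assume v: "\<forall>e\<in>product_onb. cinner e v = 0"
  have "v $ i = 0" for i
  proof (rule is_onb_eq_zero[OF some_onb])
    fix e :: 'e
    assume "e \<in> some_onb"
    then have "tensor_vec (axis i 1) e \<in> (product_onb :: ('e ^ 'n) set)"
      by (force simp: product_onb_def)
    then show "cinner e (v $ i) = 0"
      using v cinner_tensor_axis[of i e v] by auto
  qed
  then show "v = 0"
    by (simp add: vec_eq_iff)
qed

lemma summable_on_finite_Times:
  fixes f :: "'a \<times> 'b \<Rightarrow> 'c::topological_comm_monoid_add"
  assumes "finite I" "\<And>i. i \<in> I \<Longrightarrow> (\<lambda>x. f (i, x)) summable_on S"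
  shows "f summable_on I \<times> S"
  using assms
proof (induction I rule: finite_induct)
  case (insert i I)
  have "(f \<circ> Pair i) summable_on S"
    using insert.prems[of i] by (simp add: o_def)
  then have "f summable_on Pair i ` S"
    by (subst summable_on_reindex) (auto intro: inj_onI)
  moreover have "f summable_on I \<times> S"
    using insert by simp
  ultimately have "f summable_on Pair i ` S \<union> I \<times> S"
    using insert.hyps by (intro summable_on_Un_disjoint) auto
  moreover have "Pair i ` S \<union> I \<times> S = insert i I \<times> S"
    by auto
  ultimately show ?case
    by simp
qed simp

lemma summable_on_product_onb_iff:
  fixes T :: "'e::chilbert_space ^ 'n \<Rightarrow> 'e ^ 'n"
  shows "(\<lambda>v. cinner v (T v)) summable_on product_onb \<longleftrightarrow>
    (\<forall>i. (\<lambda>e. cinner (tensor_vec (axis i 1) e) (T (tensor_vec (axis i 1) e))) summable_on some_onb)"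
    (is "?L \<longleftrightarrow> (\<forall>i. ?d i summable_on _)")
proof -
  have reindex: "?L \<longleftrightarrow> (\<lambda>(i, e). ?d i e) summable_on (UNIV \<times> some_onb)"
    unfolding product_onb_def summable_on_reindex[OF inj_on_product_onb]
    by (simp add: o_def case_prod_unfold)
  show ?thesis
  proof
    assume ?L
    then have sum: "(\<lambda>(i, e). ?d i e) summable_on (UNIV \<times> some_onb)"
      using reindex by blast
    show "\<forall>i. ?d i summable_on some_onb"
    proof
      fix i
      have "(\<lambda>(i, e). ?d i e) summable_on Pair i ` some_onb"
        using sum by (rule summable_on_subset_banach) auto
      then show "?d i summable_on some_onb"
        by (subst (asm) summable_on_reindex) (auto intro: inj_onI simp: o_def)
    qed
  next
    assume "\<forall>i. ?d i summable_on some_onb"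
    then show ?L
      unfolding reindex by (intro summable_on_finite_Times) auto
  qed
qed

lemma trace_ptrace_E_eq_infsum:
  fixes T :: "'e::chilbert_space ^ 'n \<Rightarrow> 'e ^ 'n"
  assumes "(\<lambda>v. cinner v (T v)) summable_on product_onb"
  shows "trace (ptrace_E T) = (\<Sum>\<^sub>\<infinity>v\<in>product_onb. cinner v (T v))"
proof -
  let ?d = "\<lambda>i e. cinner (tensor_vec (axis i 1) e) (T (tensor_vec (axis i 1) e))"
  have "(\<lambda>(i, e). ?d i e) summable_on (UNIV \<times> some_onb)"
    using assms unfolding product_onb_def summable_on_reindex[OF inj_on_product_onb]
    by (simp add: o_def case_prod_unfold)
  from infsum_Sigma'_banach[OF this]
  have "(\<Sum>i\<in>UNIV. \<Sum>\<^sub>\<infinity>e\<in>some_onb. ?d i e) = (\<Sum>\<^sub>\<infinity>(i, e)\<in>UNIV \<times> some_onb. ?d i e)"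
    by simp
  also have "\<dots> = (\<Sum>\<^sub>\<infinity>v\<in>product_onb. cinner v (T v))"
    unfolding product_onb_def infsum_reindex[OF inj_on_product_onb]
    by (simp add: o_def case_prod_unfold)
  finally show ?thesis
    by (simp add: trace_def ptrace_E_def)
qed

text \<open>Ensures that the entries of \<open>ptrace_E\<close> are genuine sums and not the default
  value 0. For a positive operator Cauchy-Schwarz bounds an off-diagonal term by the geometric mean
  of two diagonal ones, hence by their sum.\<close>

lemma trace_span_ptrace_summable:
  fixes T :: "'e::chilbert_space ^ 'n \<Rightarrow> 'e ^ 'n"
  assumes "trace_span T"
  shows "(\<lambda>e. cinner (tensor_vec (axis i 1) e) (T (tensor_vec (axis j 1) e))) summable_on some_onb"
  using assms
proof induction
  case (positive P B)
  note P = positive_op_cases[OF positive(1)]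
  let ?t = "\<lambda>i e. tensor_vec (axis i 1) e :: 'e ^ 'n"
  let ?d = "\<lambda>i e. Re (cinner (?t i e) (P (?t i e)))"
  have diag: "?d i summable_on some_onb" for i
    using positive_op_trace_onb_indep(1)[OF positive(1,2) is_onb_product_onb positive(3)]
    unfolding summable_on_product_onb_iff by (intro summable_on_Re) simp
  show ?case
  proof (rule abs_summable_summable, rule summable_on_comparison_test)
    show "(\<lambda>e. ?d i e + ?d j e) summable_on some_onb"
      by (intro summable_on_add diag)
    fix e :: 'e
    have "(cmod (cinner (?t i e) (P (?t j e))))\<^sup>2 \<le> ?d i e * ?d j e"
      by (rule positive_op_Cauchy_Schwarz[OF positive(1)])
    also have "\<dots> \<le> (?d i e + ?d j e)\<^sup>2"
      using P(2)[of "?t i e"] P(2)[of "?t j e"]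
      by (simp add: power2_eq_square distrib_left distrib_right)
    finally show "norm (cinner (?t i e) (P (?t j e))) \<le> ?d i e + ?d j e"
      by (rule power2_le_imp_le) (use P(2)[of "?t i e"] P(2)[of "?t j e"] in simp)
  qed simp
next
  case (add S T)
  then show ?case
    unfolding cinner_add_right by (intro summable_on_add)
next
  case (scaleC T c)
  then show ?case
    unfolding cinner_scaleC_right by (intro summable_on_cmult_right)
qed

section \<open>Linearity and unitary invariance of the partial trace\<close>

lemma ptrace_E_add:
  assumes "trace_span S" "trace_span T"
  shows "ptrace_E (\<lambda>x. S x + T x) = ptrace_E S + ptrace_E T"
  using assms
  by (simp add: ptrace_E_def vec_eq_iff cinner_add_right infsum_add trace_span_ptrace_summable)

text \<open>A nonzero factor preserves divergence as well as convergence, and the default value 0 is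
  homogeneous, so this holds for every \<open>T\<close>.\<close>

lemma ptrace_E_scaleC: "ptrace_E (\<lambda>x. c *\<^sub>C T x) = c *\<^sub>C ptrace_E T"
  by (simp add: ptrace_E_def vec_eq_iff cinner_scaleC_right infsum_cmult_right')

lemma trace_scaleC: "trace (c *\<^sub>C A) = c * trace A" for A :: "complex^'n^'n"
  by (simp add: trace_def sum_distrib_left)

text \<open>In the positive case both sides sum the form of \<open>P\<close>, along the image of the
  product basis under \<open>cadjoint U\<close> and along the product basis itself. Linear
  combinations follow because conjugates stay in \<open>trace_span\<close>.\<close>

lemma trace_ptrace_E_unitary_conj:
  fixes T :: "'e::chilbert_space ^ 'n \<Rightarrow> 'e ^ 'n"
  assumes U: "unitary_op U" and "trace_span T"
  shows "trace (ptrace_E (U \<circ> T \<circ> cadjoint U)) = trace (ptrace_E T)"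
  using assms(2)
proof induction
  case (positive P B)
  let ?V = "cadjoint U"
  have form: "cinner x ((U \<circ> P \<circ> ?V) x) = cinner (?V x) (P (?V x))" for x
    by (simp add: unitary_cadjoint_cinner[OF U])
  have inj: "inj_on ?V product_onb"
    by (rule inj_on_subset[OF inj_cadjoint_unitary[OF U]]) simp
  note indep = positive_op_trace_onb_indep[OF positive(1,2) _ positive(3)]
  have prod: "(\<lambda>v. cinner v (P v)) summable_on product_onb"
    by (rule indep(1)[OF is_onb_product_onb])
  have onb: "is_onb (?V ` product_onb)"
    by (rule is_onb_cadjoint_unitary[OF U is_onb_product_onb])
  have "(\<lambda>x. cinner (?V x) (P (?V x))) summable_on product_onb"
    using indep(1)[OF onb] by (simp add: summable_on_reindex[OF inj] o_def)
  then have "trace (ptrace_E (U \<circ> P \<circ> ?V)) = (\<Sum>\<^sub>\<infinity>x\<in>product_onb. cinner (?V x) (P (?V x)))"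
    by (subst trace_ptrace_E_eq_infsum) (simp_all only: form)
  also have "\<dots> = (\<Sum>\<^sub>\<infinity>v\<in>?V ` product_onb. cinner v (P v))"
    by (simp add: infsum_reindex[OF inj] o_def)
  also have "\<dots> = (\<Sum>\<^sub>\<infinity>v\<in>product_onb. cinner v (P v))"
    using indep(2)[OF onb] indep(2)[OF is_onb_product_onb] by simp
  also have "\<dots> = trace (ptrace_E P)"
    by (rule trace_ptrace_E_eq_infsum[OF prod, symmetric])
  finally show ?case .
next
  case (add S T)
  have eq: "U \<circ> (\<lambda>x. S x + T x) \<circ> cadjoint U
      = (\<lambda>x. (U \<circ> S \<circ> cadjoint U) x + (U \<circ> T \<circ> cadjoint U) x)"
    by (simp add: fun_eq_iff bounded_clinearD[OF bounded_clinear_unitary[OF U]])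
  show ?case
    unfolding eq
    by (simp only: ptrace_E_add[OF trace_span_unitary_conj[OF U add.hyps(1)]
          trace_span_unitary_conj[OF U add.hyps(2)]] ptrace_E_add[OF add.hyps] trace_add add.IH)
next
  case (scaleC T c)
  have eq: "U \<circ> (\<lambda>x. c *\<^sub>C T x) \<circ> cadjoint U = (\<lambda>x. c *\<^sub>C (U \<circ> T \<circ> cadjoint U) x)"
    by (simp add: fun_eq_iff bounded_clinearD[OF bounded_clinear_unitary[OF U]])
  show ?case
    unfolding eq ptrace_E_scaleC trace_scaleC scaleC.IH ..
qed

lemma ptrace_E_mdagger:
  assumes "\<And>x y. cinner (S x) y = cinner x (T y)"
  shows "ptrace_E S = mdagger (ptrace_E T)"
proof -
  have "cinner x (S y) = cnj (cinner y (T x))" for x y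
    by (metis assms cinner_commute)
  then show ?thesis
    by (simp add: ptrace_E_def mdagger_def vec_eq_iff)
qed

section \<open>Tensor products with a density operator\<close>

lemma density_op_summable:
  assumes "density_op \<rho>"
  shows "(\<lambda>e. cinner e (\<rho> e)) summable_on some_onb"
  \<comment> \<open>A divergent sum would give \<open>op_trace \<rho>\<close> the value 0, not
    1.\<close>
  using assms unfolding density_op_def op_trace_def by (metis infsum_not_exists zero_neq_one)

lemma cinner_tensor_op_axis:
  assumes "bounded_clinear R"
  shows "cinner (tensor_vec (axis i 1) e) (tensor_op X R (tensor_vec (axis j 1) e))
    = X $ i $ j * cinner e (R e)"
proof -
  have "cinner (axis i 1) (X *v axis j 1) = X $ i $ j"
  proof -
    have "cinner (axis i 1) (X *v axis j 1) = (\<Sum>k\<in>UNIV. if k = i then (X *v axis j 1) $ i else 0)"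
      unfolding cinner_vec_def by (intro sum.cong refl) (auto simp: axis_def cinner_complex_def)
    then show ?thesis
      by (simp add: matrix_vector_mult_def axis_def if_distrib cong: if_cong)
  qed
  then show ?thesis
    by (simp add: tensor_op_tensor_vec[OF assms] cinner_tensor_vec)
qed

lemma trace_ptrace_E_tensor_op:
  assumes "density_op \<rho>"
  shows "trace (ptrace_E (tensor_op X \<rho>)) = trace X"
proof -
  have \<rho>: "bounded_clinear \<rho>"
    using assms positive_op_cases(1) unfolding density_op_def by blast
  have "(\<Sum>\<^sub>\<infinity>e\<in>some_onb. cinner e (\<rho> e)) = 1"
    using assms by (simp add: density_op_def op_trace_def)
  then show ?thesis
    by (simp add: trace_def ptrace_E_def cinner_tensor_op_axis[OF \<rho>] infsum_cmult_right')
qed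

text \<open>Over the fourth roots of unity \<open>c\<close> and \<open>c * c\<close> sum to 0 while
  \<open>c * cnj c\<close> sums to 4, so only \<open>ketbra a b\<close> survives the expansion. This
  expresses every matrix through the positive \<open>ketbra u u\<close>.\<close>

lemma ketbra_polarization:
  "ketbra a b = (\<Sum>c\<in>{1, -1, \<i>, -\<i>}. (c / 4) *\<^sub>C ketbra (a + c *\<^sub>C b) (a + c *\<^sub>C b))"
  by (simp add: vec_eq_iff ketbra_def complex_eq_iff) (simp add: field_simps)

lemma matrix_eq_sum_ketbra:
  "X = (\<Sum>i\<in>UNIV. \<Sum>j\<in>UNIV. X $ i $ j *\<^sub>C ketbra (axis i 1) (axis j 1))"
proof -
  have "(\<Sum>i\<in>UNIV. \<Sum>j\<in>UNIV. X $ i $ j *\<^sub>C ketbra (axis i 1) (axis j 1)) $ k $ l = X $ k $ l" for k l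
  proof -
    have "(\<Sum>i\<in>UNIV. \<Sum>j\<in>UNIV. X $ i $ j *\<^sub>C ketbra (axis i 1) (axis j 1)) $ k $ l
        = (\<Sum>i\<in>UNIV. \<Sum>j\<in>UNIV. if i = k then (if j = l then X $ k $ l else 0) else 0)"
      unfolding sum_component by (intro sum.cong refl) (auto simp: ketbra_def axis_def)
    also have "\<dots> = (\<Sum>i\<in>UNIV. if i = k then X $ k $ l else 0)"
      by (intro sum.cong refl) auto
    finally show ?thesis
      by simp
  qed
  then show ?thesis
    by (simp add: vec_eq_iff)
qed

text \<open>After polarisation each \<open>ketbra u u\<close> tensored with \<open>\<rho>\<close> is
  positive, and its diagonal in the product basis consists of multiples of the convergent diagonal
  of \<open>\<rho>\<close>.\<close>

lemma trace_span_tensor_op: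
  assumes \<rho>: "density_op \<rho>"
  shows "trace_span (tensor_op X \<rho>)"
proof -
  have pos: "positive_op \<rho>"
    using \<rho> by (simp add: density_op_def)
  note P = positive_op_cases[OF pos]
  have diag: "trace_span (tensor_op (ketbra u u) \<rho>)" for u
  proof (rule trace_span.positive[OF positive_op_tensor_ketbra[OF pos] is_onb_product_onb])
    show "(\<lambda>v. cinner v (tensor_op (ketbra u u) \<rho> v)) summable_on product_onb"
      unfolding summable_on_product_onb_iff cinner_tensor_op_axis[OF P(1)]
      by (intro allI summable_on_cmult_right density_op_summable[OF \<rho>])
  qed
  have "trace_span (tensor_op (ketbra a b) \<rho>)" for a b
    by (subst ketbra_polarization, subst tensor_op_sum)
      (auto simp only: tensor_op_scaleC finite_insert finite.emptyI
        intro!: trace_span_sum trace_span.scaleC diag)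
  then show ?thesis
    by (subst matrix_eq_sum_ketbra, subst tensor_op_sum, simp, subst tensor_op_sum, simp)
      (auto simp only: tensor_op_scaleC intro!: trace_span_sum trace_span.scaleC)
qed


section \<open>Reduced dynamics\<close>

text \<open>Even additivity rests on convergence: the sums in \<open>ptrace_E\<close> are split
  using that the conjugated products lie in \<open>trace_span\<close>.\<close>

lemma Phi_add:
  assumes "unitary_op (U t)" "density_op \<rho>"
  shows "Phi U \<rho> t (X + Y) = Phi U \<rho> t X + Phi U \<rho> t Y"
proof -
  have "U t \<circ> tensor_op (X + Y) \<rho> \<circ> cadjoint (U t)
      = (\<lambda>x. (U t \<circ> tensor_op X \<rho> \<circ> cadjoint (U t)) x + (U t \<circ> tensor_op Y \<rho> \<circ> cadjoint (U t)) x)"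
    by (simp add: fun_eq_iff tensor_op_add bounded_clinearD[OF bounded_clinear_unitary[OF assms(1)]])
  then show ?thesis
    unfolding Phi_def using assms
    by (simp only: ptrace_E_add trace_span_unitary_conj trace_span_tensor_op)
qed

lemma Phi_scaleC:
  assumes "unitary_op (U t)"
  shows "Phi U \<rho> t (c *\<^sub>C X) = c *\<^sub>C Phi U \<rho> t X"
proof -
  have "U t \<circ> tensor_op (c *\<^sub>C X) \<rho> \<circ> cadjoint (U t)
      = (\<lambda>x. c *\<^sub>C (U t \<circ> tensor_op X \<rho> \<circ> cadjoint (U t)) x)"
    by (simp add: fun_eq_iff tensor_op_scaleC
        bounded_clinearD[OF bounded_clinear_unitary[OF assms(1)]])
  then show ?thesis
    unfolding Phi_def by (simp only: ptrace_E_scaleC)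
qed

lemma trace_Phi:
  assumes "unitary_op (U t)" "density_op \<rho>"
  shows "trace (Phi U \<rho> t X) = trace X"
  unfolding Phi_def using assms
  by (simp add: trace_ptrace_E_unitary_conj trace_span_tensor_op trace_ptrace_E_tensor_op)

lemma Phi_mdagger:
  assumes U: "unitary_op (U t)" and "density_op \<rho>"
  shows "Phi U \<rho> t (mdagger X) = mdagger (Phi U \<rho> t X)"
proof -
  have "positive_op \<rho>"
    using assms(2) by (simp add: density_op_def)
  then show ?thesis
    unfolding Phi_def
    by (intro ptrace_E_mdagger)
      (simp add: unitary_cadjoint_cinner[OF U] unitary_cadjoint_cinner_right[OF U, symmetric]
        tensor_op_mdagger positive_op_hermitian)
qed

lemma trace_Icorr:
  assumes "unitary_op (U t)" "hermitian_op chi" "trace_class chi" "ptrace_E chi = 0"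
  shows "trace (Icorr U chi t) = 0"
proof -
  have "trace (Icorr U chi t) = trace (ptrace_E chi)"
    unfolding Icorr_def using assms
    by (intro trace_ptrace_E_unitary_conj trace_span_if_trace_class)
  then show ?thesis
    by (simp add: assms(4) trace_def)
qed

lemma Icorr_mdagger:
  assumes U: "unitary_op (U t)" and "hermitian_op chi"
  shows "mdagger (Icorr U chi t) = Icorr U chi t"
  unfolding Icorr_def using assms(2)
  by (intro ptrace_E_mdagger[symmetric])
    (simp add: unitary_cadjoint_cinner[OF U] unitary_cadjoint_cinner_right[OF U, symmetric]
      hermitian_op_def)

section \<open>Matrices of the system space\<close>

lemma scaleC_matrix_mult_left: "(c *\<^sub>C A) ** B = c *\<^sub>C (A ** B)"
  and scaleC_matrix_mult_right: "A ** (c *\<^sub>C B) = c *\<^sub>C (A ** B)"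
  for A B :: "complex^'n::finite^'n"
  by (simp_all add: vec_eq_iff matrix_matrix_mult_def sum_distrib_left mult_ac)

lemma scaleR_matrix_mult_left: "(r *\<^sub>R A) ** B = r *\<^sub>R (A ** B)"
  and scaleR_matrix_mult_right: "A ** (r *\<^sub>R B) = r *\<^sub>R (A ** B)"
  for A B :: "complex^'n::finite^'n"
  by (simp_all add: scaleR_scaleC[where 'a = "complex^'n^'n"] scaleC_matrix_mult_left
      scaleC_matrix_mult_right)

lemma matrix_mult_distribs:
  "(A + B) ** C = A ** C + B ** C" "A ** (B + C) = A ** B + A ** C"
  "(A - B) ** C = A ** C - B ** C" "A ** (B - C) = A ** B - A ** C"
  for A B C :: "complex^'n::finite^'n"
  by (simp_all add: vec_eq_iff matrix_matrix_mult_def distrib_left distrib_right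
      left_diff_distrib right_diff_distrib sum.distrib sum_subtractf)

lemma matrix_mult_sum_left: "(\<Sum>i\<in>I. A i) ** B = (\<Sum>i\<in>I. A i ** B)"
  and matrix_mult_sum_right: "B ** (\<Sum>i\<in>I. A i) = (\<Sum>i\<in>I. B ** A i)"
  for B :: "complex^'n::finite^'n"
  by (induction I rule: infinite_finite_induct)
    (simp_all add: matrix_mult_distribs)

lemma sum_matrix_vector_mult: "(\<Sum>i\<in>I. A i) *v x = (\<Sum>i\<in>I. A i *v x)"
  for A :: "'i \<Rightarrow> complex^'n::finite^'n"
  by (induction I rule: infinite_finite_induct) (simp_all add: matrix_vector_mult_add_rdistrib)

lemma trace_sum: "trace (\<Sum>i\<in>I. A i) = (\<Sum>i\<in>I. trace (A i))"
  for A :: "'i \<Rightarrow> complex^'n::finite^'n"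
  unfolding trace_def sum_component by (rule sum.swap)

lemma mdagger_ketbra: "mdagger (ketbra x y) = ketbra y x"
  by (simp add: mdagger_def ketbra_def vec_eq_iff mult.commute)

lemma trace_ketbra: "trace (ketbra x y) = cinner y x"
  by (simp add: trace_def ketbra_def cinner_vec_def cinner_complex_def mult.commute)

lemma matrix_mult_ketbra: "A ** ketbra x y = ketbra (A *v x) y"
  by (simp add: vec_eq_iff matrix_matrix_mult_def matrix_vector_mult_def ketbra_def
      sum_distrib_right mult.assoc)

lemma ketbra_scaleC_left: "ketbra (c *\<^sub>C x) y = c *\<^sub>C ketbra x y"
  by (simp add: vec_eq_iff ketbra_def)

lemma ketbra_mult_ketbra: "ketbra a b ** ketbra c d = cinner b c *\<^sub>C ketbra a d"
  by (simp add: matrix_mult_ketbra ketbra_apply ketbra_scaleC_left)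

lemma ketbra_sandwich: "ketbra a b ** X ** ketbra c d = cinner b (X *v c) *\<^sub>C ketbra a d"
  by (simp add: matrix_mul_assoc[symmetric] matrix_mult_ketbra[of X] ketbra_mult_ketbra)

text \<open>The sandwich contributes \<open>- r (G X + X G)\<close> and the anticommutator its
  opposite; the terms in \<open>r * r\<close> cancel too. As \<open>r\<close> is real and
  \<open>G\<close> Hermitian, no commutator with \<open>X\<close> is left over.\<close>

lemma Lindblad_term_shift:
  fixes G X :: "complex^'n::finite^'n"
  assumes G: "mdagger G = G" and L: "L = G - r *\<^sub>R mat 1"
  shows "L ** X ** mdagger L - (1/2) *\<^sub>R anticommutator (mdagger L ** L) X
    = G ** X ** mdagger G - (1/2) *\<^sub>R anticommutator (mdagger G ** G) X"
proof -
  have "mdagger L = L"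
    using G by (simp add: L mdagger_def vec_eq_iff mat_def)
  then show ?thesis
    unfolding G unfolding L anticommutator_def
    by (simp add: matrix_mult_distribs scaleR_matrix_mult_left
        scaleR_matrix_mult_right matrix_mul_assoc[symmetric])
      (simp add: vec_eq_iff scaleR_conv_of_real[where 'a = complex] algebra_simps)
qed

section \<open>The dissipator of an orthonormal eigenbasis\<close>

locale orthonormal_eigenbasis =
  fixes \<eta> :: "'n::finite \<Rightarrow> complex^'n" and b :: "'n \<Rightarrow> real" and M :: "complex^'n^'n"
  assumes inj: "inj \<eta>" and onb: "is_onb (range \<eta>)" and eigen: "M *v \<eta> j = b j *\<^sub>R \<eta> j"
begin

text \<open>\<open>is_onb (range \<eta>)\<close> speaks of a set of vectors only; injectivity makes
  vectors with distinct indices orthogonal.\<close>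

lemma cinner_basis: "cinner (\<eta> i) (\<eta> j) = (if i = j then 1 else 0)"
  using orthonormalD[OF is_onb_orthonormal[OF onb], of "\<eta> i" "\<eta> j"] inj by (auto simp: inj_eq)

lemma sum_projections: "(\<Sum>j\<in>UNIV. ketbra (\<eta> j) (\<eta> j)) = mat 1"
proof -
  have "(\<Sum>j\<in>UNIV. cinner (\<eta> j) x *\<^sub>C \<eta> j) - x = 0" for x
  proof (rule is_onb_eq_zero[OF onb])
    fix e
    assume "e \<in> range \<eta>"
    then obtain k where e: "e = \<eta> k"
      by blast
    have "cinner e (\<Sum>j\<in>UNIV. cinner (\<eta> j) x *\<^sub>C \<eta> j) = (\<Sum>j\<in>UNIV. if k = j then cinner (\<eta> j) x else 0)"
      unfolding e cinner_sum_right cinner_scaleC_right cinner_basis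
      by (intro sum.cong refl) auto
    then show "cinner e ((\<Sum>j\<in>UNIV. cinner (\<eta> j) x *\<^sub>C \<eta> j) - x) = 0"
      by (simp add: cinner_diff_right e)
  qed
  then have "(\<Sum>j\<in>UNIV. ketbra (\<eta> j) (\<eta> j)) *v x = mat 1 *v x" for x
    by (simp add: sum_matrix_vector_mult ketbra_apply)
  then show ?thesis
    by (simp add: matrix_eq)
qed

lemma trace_eq_sum: "trace X = (\<Sum>j\<in>UNIV. cinner (\<eta> j) (X *v \<eta> j))"
proof -
  have "trace X = trace (X ** mat 1)"
    by simp
  then show ?thesis
    unfolding sum_projections[symmetric]
    by (simp add: matrix_mult_sum_right trace_sum matrix_mult_ketbra trace_ketbra)
qed

lemma spectral_decomposition: "M = (\<Sum>j\<in>UNIV. b j *\<^sub>R ketbra (\<eta> j) (\<eta> j))"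
proof -
  have "M = M ** mat 1"
    by simp
  then show ?thesis
    unfolding sum_projections[symmetric]
    by (simp add: matrix_mult_sum_right matrix_mult_ketbra eigen scaleR_scaleC ketbra_scaleC_left)
qed

lemma trace_eigenvalues: "trace M = (\<Sum>j\<in>UNIV. complex_of_real (b j))"
  unfolding trace_eq_sum eigen cinner_scaleR_right by (simp add: cinner_basis scaleR_conv_of_real)

text \<open>For \<open>i = j\<close> the shift is the real number \<open>1 / real CARD('n)\<close>,
  for \<open>i \<noteq> j\<close> there is none. On the right \<open>X\<close> meets only the index
  \<open>j\<close>, so summing over \<open>j\<close> at fixed \<open>i\<close> produces the trace of
  \<open>X\<close> and the resolution of the identity.\<close>

lemma Lindblad_term_traceless_part:
  fixes X :: "complex^'n^'n"
  defines "L \<equiv> \<lambda>i j. traceless_part (ketbra (\<eta> i) (\<eta> j))"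
  shows "L i j ** X ** mdagger (L i j) - (1/2) *\<^sub>R anticommutator (mdagger (L i j) ** L i j) X
    = cinner (\<eta> j) (X *v \<eta> j) *\<^sub>C ketbra (\<eta> i) (\<eta> i) - (1/2) *\<^sub>R anticommutator (ketbra (\<eta> j) (\<eta> j)) X"
proof -
  let ?G = "ketbra (\<eta> i) (\<eta> j)"
  have "L i j ** X ** mdagger (L i j) - (1/2) *\<^sub>R anticommutator (mdagger (L i j) ** L i j) X
    = ?G ** X ** mdagger ?G - (1/2) *\<^sub>R anticommutator (mdagger ?G ** ?G) X"
  proof (cases "i = j")
    case True
    then have "L i j = ?G - (1 / real CARD('n)) *\<^sub>R mat 1"
      by (simp add: L_def traceless_part_def trace_ketbra cinner_basis scaleR_scaleC)
    then show ?thesis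
      using True by (intro Lindblad_term_shift[where r = "1 / real CARD('n)"]) (simp_all add: mdagger_ketbra)
  next
    case False
    then have "L i j = ?G"
      by (simp add: L_def traceless_part_def trace_ketbra cinner_basis)
    then show ?thesis
      by simp
  qed
  then show ?thesis
    by (simp add: mdagger_ketbra ketbra_sandwich ketbra_mult_ketbra cinner_basis)
qed

lemma dissipator_traceless_part:
  assumes "trace M = 0"
  shows "dissipator UNIV (\<lambda>(j, j'). b j) (\<lambda>i. traceless_part ((\<lambda>(j, j'). ketbra (\<eta> j) (\<eta> j')) i)) X
    = trace X *\<^sub>C M"
proof -
  let ?K = "\<lambda>j. ketbra (\<eta> j) (\<eta> j)"
  let ?c = "\<lambda>j. cinner (\<eta> j) (X *v \<eta> j)"
  have "dissipator UNIV (\<lambda>(j, j'). b j) (\<lambda>i. traceless_part ((\<lambda>(j, j'). ketbra (\<eta> j) (\<eta> j')) i)) X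
      = (\<Sum>(i, j)\<in>UNIV \<times> UNIV. b i *\<^sub>R (?c j *\<^sub>C ?K i - (1/2) *\<^sub>R anticommutator (?K j) X))"
    unfolding dissipator_def UNIV_Times_UNIV
    by (intro sum.cong refl) (clarsimp simp: Lindblad_term_traceless_part)
  also have "\<dots> = (\<Sum>i\<in>UNIV. b i *\<^sub>R (\<Sum>j\<in>UNIV. ?c j *\<^sub>C ?K i - (1/2) *\<^sub>R anticommutator (?K j) X))"
    unfolding sum.cartesian_product[symmetric] scaleR_right.sum ..
  also have "\<dots> = (\<Sum>i\<in>UNIV. b i *\<^sub>R (trace X *\<^sub>C ?K i - X))"
  proof (intro sum.cong refl arg_cong[where f = "\<lambda>A. b _ *\<^sub>R A"])
    fix i
    have "(\<Sum>j\<in>UNIV. anticommutator (?K j) X) = 2 *\<^sub>R X"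
      by (simp add: anticommutator_def sum.distrib matrix_mult_sum_left[symmetric]
          matrix_mult_sum_right[symmetric] sum_projections scaleR_2)
    then have "(\<Sum>j\<in>UNIV. (1/2) *\<^sub>R anticommutator (?K j) X) = X"
      by (simp add: scaleR_right.sum[symmetric])
    then show "(\<Sum>j\<in>UNIV. ?c j *\<^sub>C ?K i - (1/2) *\<^sub>R anticommutator (?K j) X) = trace X *\<^sub>C ?K i - X"
      by (simp add: sum_subtractf sum_scaleC trace_eq_sum)
  qed
  also have "\<dots> = trace X *\<^sub>C M - (\<Sum>i\<in>UNIV. b i) *\<^sub>R X"
    by (subst spectral_decomposition)
      (simp add: scaleR_diff_right sum_subtractf scaleR_left.sum scaleC_sum_right
        linear_scale[OF bounded_linear.linear[OF bounded_linear_scaleC_right]])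
  also have "(\<Sum>i\<in>UNIV. b i) = 0"
    using trace_eigenvalues assms by (metis of_real_sum of_real_eq_0_iff)
  finally show ?thesis
    by simp
qed

text \<open>The summands vanish one by one, whatever the weights.\<close>

lemma corr_hamiltonian_eq_zero: "corr_hamiltonian UNIV g (\<lambda>(j, j'). ketbra (\<eta> j) (\<eta> j')) = 0"
proof -
  have "trace (ketbra (\<eta> i) (\<eta> j)) *\<^sub>C mdagger (ketbra (\<eta> i) (\<eta> j))
    = trace (mdagger (ketbra (\<eta> i) (\<eta> j))) *\<^sub>C ketbra (\<eta> i) (\<eta> j)" for i j
    by (simp add: mdagger_ketbra trace_ketbra cinner_basis)
  then show ?thesis
    by (simp add: corr_hamiltonian_def case_prod_unfold)
qed

end

lemma trace_traceless_part: "trace (traceless_part G) = 0" for G :: "complex^'n::finite^'n"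
  by (simp add: traceless_part_def trace_sub trace_scaleC trace_I)


section \<open>Generators\<close>

text \<open>Uniqueness of the derivative needs a proper filter; \<open>t\<close> is a limit of later
  times, which also covers the one-sided derivative at 0.\<close>

lemma tderiv_eqI:
  assumes "t \<ge> 0" "(f has_vector_derivative D) (at t within {0..})"
  shows "tderiv f t = D"
proof -
  have "t islimpt {t<..<t + 1}"
    by (rule islimpt_greaterThanLessThan1) simp
  then have "t islimpt {0..}"
    by (rule islimpt_subset) (use assms(1) in auto)
  then have "at t within {0..} \<noteq> bot"
    by (simp add: trivial_limit_within)
  then show ?thesis
    unfolding tderiv_def using assms(2) by (rule vector_derivative_within)
qed

lemma has_vector_derivative_tderiv:
  "tdifferentiable f \<Longrightarrow> t \<ge> 0 \<Longrightarrow> (f has_vector_derivative tderiv f t) (at t within {0..})"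
  unfolding tdifferentiable_def tderiv_def by (simp add: vector_derivative_works)

lemma bounded_linear_trace: "bounded_linear (trace :: complex^'n::finite^'n \<Rightarrow> complex)"
  by (rule linear_conv_bounded_linear[THEN iffD1], rule linearI)
    (simp_all add: trace_def scaleR_sum_right sum.distrib)

text \<open>The adjoint is conjugate-linear, hence real linear, which suffices for exchanging it
  with a derivative in real time.\<close>

lemma bounded_linear_mdagger: "bounded_linear (mdagger :: complex^'n::finite^'n \<Rightarrow> _)"
  by (rule linear_conv_bounded_linear[THEN iffD1], rule linearI)
    (simp_all add: mdagger_def vec_eq_iff)

lemma mdagger_diff: "mdagger (A - B) = mdagger A - mdagger B" for A B :: "complex^'n::finite^'n"
  by (rule linear_diff[OF bounded_linear.linear[OF bounded_linear_mdagger]])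

text \<open>What the generator argument uses of \<open>Phi\<close> and \<open>Icorr\<close>. The
  algebraic laws are required at all times \<open>s \<ge> 0\<close> and not just at
  \<open>t\<close>, because they get differentiated.\<close>

locale correlated_dynamics =
  fixes F :: "real \<Rightarrow> complex^'n::finite^'n \<Rightarrow> complex^'n^'n"
    and I :: "real \<Rightarrow> complex^'n^'n"
    and t :: real
  assumes F_add: "\<And>s X Y. s \<ge> 0 \<Longrightarrow> F s (X + Y) = F s X + F s Y"
    and F_scaleC: "\<And>s c X. s \<ge> 0 \<Longrightarrow> F s (c *\<^sub>C X) = c *\<^sub>C F s X"
    and trace_F: "\<And>s X. s \<ge> 0 \<Longrightarrow> trace (F s X) = trace X"
    and F_mdagger: "\<And>s X. s \<ge> 0 \<Longrightarrow> F s (mdagger X) = mdagger (F s X)"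
    and trace_I: "\<And>s. s \<ge> 0 \<Longrightarrow> trace (I s) = 0"
    and I_mdagger: "\<And>s. s \<ge> 0 \<Longrightarrow> mdagger (I s) = I s"
    and F_diff: "\<And>X. tdifferentiable (\<lambda>s. F s X)"
    and I_diff: "tdifferentiable I"
    and t: "t \<ge> 0"
    and bij: "bij (F t)"
begin

abbreviation "D X \<equiv> tderiv (\<lambda>s. F s X) t"
abbreviation "G \<equiv> inv (F t)"
abbreviation "P s X \<equiv> F s X + trace X *\<^sub>C I s"
abbreviation "J \<equiv> tderiv I t - generator F t (I t)"

lemmas D = has_vector_derivative_tderiv[OF F_diff t]
lemmas DI = has_vector_derivative_tderiv[OF I_diff t]

lemma F_G: "F t (G X) = X"
  using bij by (simp add: bij_is_surj surj_f_inv_f)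

lemma G_F: "G (F t X) = X"
  using bij by (simp add: bij_is_inj)

lemma G_eqI: "F t X = Y \<Longrightarrow> G Y = X"
  using G_F by blast

lemma tderiv_eqI_on:
  "(f has_vector_derivative E) (at t within {0..}) \<Longrightarrow> (\<And>s. s \<ge> 0 \<Longrightarrow> g s = f s) \<Longrightarrow> tderiv g t = E"
  by (rule tderiv_eqI[OF t]) (rule has_vector_derivative_transform[of _ _ g f], use t in auto)

lemma D_add: "D (X + Y) = D X + D Y"
  by (rule tderiv_eqI_on[OF has_vector_derivative_add[OF D D]]) (rule F_add)

lemma D_scaleC: "D (c *\<^sub>C X) = c *\<^sub>C D X"
  by (rule tderiv_eqI_on[OF bounded_linear.has_vector_derivative[OF bounded_linear_scaleC_right D]])
    (rule F_scaleC)

lemma D_mdagger: "D (mdagger X) = mdagger (D X)"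
  by (rule tderiv_eqI_on[OF bounded_linear.has_vector_derivative[OF bounded_linear_mdagger D]])
    (rule F_mdagger)

lemma trace_D: "trace (D X) = 0"
proof -
  have "tderiv (\<lambda>s. trace (F s X)) t = trace (D X)"
    by (rule tderiv_eqI_on[OF bounded_linear.has_vector_derivative[OF bounded_linear_trace D]]) simp
  moreover have "tderiv (\<lambda>s. trace (F s X)) t = 0"
    by (rule tderiv_eqI_on[OF has_vector_derivative_const[of "trace X"]]) (rule trace_F)
  ultimately show ?thesis
    by simp
qed

lemma tderiv_I_mdagger: "mdagger (tderiv I t) = tderiv I t"
  by (rule sym, rule tderiv_eqI_on[OF bounded_linear.has_vector_derivative[OF bounded_linear_mdagger DI]])
    (simp add: I_mdagger)

lemma trace_tderiv_I: "trace (tderiv I t) = 0"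
proof -
  have "tderiv (\<lambda>s. trace (I s)) t = trace (tderiv I t)"
    by (rule tderiv_eqI_on[OF bounded_linear.has_vector_derivative[OF bounded_linear_trace DI]]) simp
  moreover have "tderiv (\<lambda>s. trace (I s)) t = 0"
    by (rule tderiv_eqI_on[OF has_vector_derivative_const[of 0]]) (rule trace_I)
  ultimately show ?thesis
    by simp
qed

lemma G_mdagger: "G (mdagger X) = mdagger (G X)"
  by (rule G_eqI) (simp add: F_mdagger[OF t] F_G)

lemma trace_G: "trace (G X) = trace X"
  using trace_F[OF t, of "G X"] by (simp add: F_G)

text \<open>\<open>D\<close> and \<open>G\<close> both commute with \<open>mdagger\<close>, so the
  generator keeps the Hermitian matrix \<open>I t\<close> Hermitian.\<close>

lemma hermitian_mat_J: "hermitian_mat J"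
  by (simp add: hermitian_mat_def mdagger_diff tderiv_I_mdagger generator_def D_mdagger[symmetric]
      G_mdagger[symmetric] I_mdagger[OF t])

lemma trace_J: "trace J = 0"
  by (simp add: trace_sub trace_tderiv_I generator_def trace_D)

text \<open>The inverse of \<open>P t\<close>. As \<open>P t\<close> preserves the trace, the
  multiple of \<open>I t\<close> contained in \<open>X\<close> is \<open>trace X\<close>; it is
  subtracted before applying \<open>G\<close>.\<close>

definition P_inv :: "complex^'n^'n \<Rightarrow> complex^'n^'n" where
  "P_inv X = G X + (- trace X) *\<^sub>C G (I t)"

lemma trace_P_inv: "trace (P_inv X) = trace X"
  by (simp add: P_inv_def trace_add trace_scaleC trace_G trace_I[OF t])

lemma P_P_inv: "P t (P_inv X) = X"
  unfolding trace_P_inv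
  unfolding P_inv_def F_add[OF t] F_scaleC[OF t] F_G by (simp add: scaleC_minus_left)

lemma P_inv_P: "P_inv (P t X) = X"
proof -
  have "G (F t X + trace X *\<^sub>C I t) = X + trace X *\<^sub>C G (I t)"
    by (rule G_eqI) (simp add: F_add[OF t] F_scaleC[OF t] F_G)
  then show ?thesis
    by (simp add: P_inv_def trace_add trace_scaleC trace_F[OF t] trace_I[OF t] scaleC_minus_left)
qed

lemma bij_P: "bij (P t)"
  by (rule o_bij[of P_inv]) (simp_all add: fun_eq_iff P_P_inv P_inv_P)

lemma inv_P: "inv (P t) = P_inv"
  by (rule inv_unique_comp) (simp_all add: fun_eq_iff P_P_inv P_inv_P)

text \<open>Because \<open>P_inv\<close> preserves the trace, differentiating \<open>I\<close>
  contributes \<open>trace X\<close> times \<open>tderiv I t\<close>, while the correction in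
  \<open>P_inv\<close> contributes \<open>- trace X\<close> times \<open>D (G (I t))\<close>. These
  are the two terms of \<open>J\<close>.\<close>

lemma generator_P: "generator P t X = generator F t X + trace X *\<^sub>C J"
proof -
  have "tderiv (\<lambda>s. P s Y) t = D Y + trace Y *\<^sub>C tderiv I t" for Y
    by (rule tderiv_eqI_on[OF has_vector_derivative_add[OF D
            bounded_linear.has_vector_derivative[OF bounded_linear_scaleC_right DI]]]) simp
  then have "generator P t X = D (P_inv X) + trace X *\<^sub>C tderiv I t"
    by (simp add: generator_def inv_P trace_P_inv)
  also have "D (P_inv X) = D (G X) + (- trace X) *\<^sub>C D (G (I t))"
    unfolding P_inv_def D_add D_scaleC ..
  finally show ?thesis
    by (simp add: generator_def scaleC_diff_right scaleC_minus_left)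
qed

end

theorem mainTheorem4:
  fixes U :: "real \<Rightarrow> 'e::chilbert_space ^ 'n::finite \<Rightarrow> 'e ^ 'n"
    and \<rho> :: "'e \<Rightarrow> 'e"
    and chi :: "'e ^ 'n \<Rightarrow> 'e ^ 'n"
    and t :: real
  assumes "\<And>s. s \<ge> 0 \<Longrightarrow> unitary_op (U s)"
    and "density_op \<rho>"
    and "hermitian_op chi" and "trace_class chi"
    and "ptrace_E chi = 0" and "ptrace_S chi = (\<lambda>y. 0)"
    and "\<And>X. tdifferentiable (\<lambda>s. Phi U \<rho> s X)"
    and "tdifferentiable (Icorr U chi)"
    and "t \<ge> 0" and "bij (Phi U \<rho> t)"
  shows "bij (Psi U \<rho> chi t) \<and> hermitian_mat (Jcorr U \<rho> chi t) \<and>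
    (\<forall>(\<eta> :: 'n \<Rightarrow> complex ^ 'n) (b :: 'n \<Rightarrow> real).
       inj \<eta> \<and> is_onb (range \<eta>) \<and> (\<forall>j. Jcorr U \<rho> chi t *v \<eta> j = b j *\<^sub>R \<eta> j) \<longrightarrow>
       (let G = (\<lambda>(j, j'). ketbra (\<eta> j) (\<eta> j'));
            g = (\<lambda>(j, j'). b j);
            J = (\<lambda>i. traceless_part (G i))
        in (\<forall>i. trace (J i) = 0) \<and>
           (\<forall>X. trace X *\<^sub>C Jcorr U \<rho> chi t = dissipator UNIV g J X) \<and>
           corr_hamiltonian UNIV g G = 0 \<and>
           (\<forall>K (A :: 'k set) lam L.
              hermitian_mat K \<and> finite A \<and> (\<forall>k\<in>A. trace (L k) = 0) \<and>
              (\<forall>X. generator (Phi U \<rho>) t X = - (\<i> *\<^sub>C commutator K X) + dissipator A lam L X) \<longrightarrow>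
              (\<forall>X. generator (Psi U \<rho> chi) t X =
                 - (\<i> *\<^sub>C commutator K X) + dissipator A lam L X + dissipator UNIV g J X))))"
proof -
  \<comment> \<open>The infinite-dimensional part of the argument enters through these locale
    assumptions; from here on only matrices of the system occur.\<close>
  interpret dyn: correlated_dynamics "Phi U \<rho>" "Icorr U chi" t
    using assms
    by unfold_locales
      (simp_all add: Phi_add Phi_scaleC trace_Phi Phi_mdagger trace_Icorr Icorr_mdagger)
  have Psi: "Psi U \<rho> chi = (\<lambda>s X. Phi U \<rho> s X + trace X *\<^sub>C Icorr U chi s)"
    by (simp add: fun_eq_iff Psi_def)
  let ?J = "Jcorr U \<rho> chi t"
  have bij: "bij (Psi U \<rho> chi t)"
    unfolding Psi by (rule dyn.bij_P)
  have herm: "hermitian_mat ?J"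
    unfolding Jcorr_def by (rule dyn.hermitian_mat_J)
  have trace: "trace ?J = 0"
    unfolding Jcorr_def by (rule dyn.trace_J)
  have gen: "generator (Psi U \<rho> chi) t X = generator (Phi U \<rho>) t X + trace X *\<^sub>C ?J" for X
    unfolding Psi Jcorr_def by (rule dyn.generator_P)
  have diss: "dissipator UNIV (\<lambda>(j, j'). b j) (\<lambda>i. traceless_part ((\<lambda>(j, j'). ketbra (\<eta> j) (\<eta> j')) i)) X
      = trace X *\<^sub>C ?J"
    and ham: "corr_hamiltonian UNIV (\<lambda>(j, j'). b j) (\<lambda>(j, j'). ketbra (\<eta> j) (\<eta> j')) = 0"
    if "inj \<eta> \<and> is_onb (range \<eta>) \<and> (\<forall>j. ?J *v \<eta> j = b j *\<^sub>R \<eta> j)"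
    for \<eta> :: "'n \<Rightarrow> complex ^ 'n" and b X
  proof -
    interpret orthonormal_eigenbasis \<eta> b ?J
      using that by unfold_locales auto
    show "dissipator UNIV (\<lambda>(j, j'). b j) (\<lambda>i. traceless_part ((\<lambda>(j, j'). ketbra (\<eta> j) (\<eta> j')) i)) X
      = trace X *\<^sub>C ?J"
      by (rule dissipator_traceless_part[OF trace])
    show "corr_hamiltonian UNIV (\<lambda>(j, j'). b j) (\<lambda>(j, j'). ketbra (\<eta> j) (\<eta> j')) = 0"
      by (rule corr_hamiltonian_eq_zero)
  qed
  show ?thesis
    unfolding Let_def
  proof (intro conjI allI impI bij herm trace_traceless_part, goal_cases)
    case (1 \<eta> b X)
    show ?case
      by (rule diss[OF 1, symmetric])
  next
    case (2 \<eta> b)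
    show ?case
      by (rule ham[OF 2])
  next
    case (3 \<eta> b K A lam L X)
    then show ?case
      unfolding gen diss[OF 3(1)] by simp
  qed
qed

end
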